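(* Let $q$ be a prime power and let $d,k,r,s,t$ be integers with $d$ even, $2 \le d/2 \le k \le (r+s)/2$, $k \le r$, $k \le s+t$, and $0 \le t \le k-d/2$. Let $\mathcal{A}$ be an $(r,\#\mathcal{A},d;k)_q$ constant-dimension code, let $\mathcal{B}$ be an $(s+t,\#\mathcal{B},d;k)_q$ constant-dimension code, let $\mathcal{M}\subseteq \mathbb{F}_q^{k\times s}$ be a rank-metric code with minimum rank distance at least $d/2$, and let $\mathcal{R}\subseteq\mathbb{F}_q^{k\times(r-t)}$ be a rank-metric code with minimum rank distance at least $d/2$ all of whose elements have rank at most $k-d/2-t$. Then $$\{\tau^{-1}(\tau(A) \mid M) : A \in \mathcal{A}, M \in \mathcal{M}\}\cup\{\tau^{-1}(R \mid \tau(B)) : R \in \mathcal{R}, B \in \mathcal{B}\}$$ is an $(r+s,\#\mathcal{A}\cdot\#\mathcal{M}+\#\mathcal{R}\cdot\#\mathcal{B},d;k)_q$ constant-dimension code. In particular, $$A_q(r+s,d;k)\ge A_q(r,d;k)\cdot M(q,k,s,d/2)+A_q(s+t,d;k)\cdot\Lambda(q,k,r-t,d/2,k-d/2-t).$$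
   Context: For subspaces $U,W$ of $\mathbb{F}_q^v$, the subspace distance is $d_S(U,W)=\dim(U+W)-\dim(U\cap W)$. A $(v,N,d;k)_q$ constant-dimension code (CDC) is a set of $N$ distinct $k$-dimensional subspaces of $\mathbb{F}_q^v$ with pairwise subspace distance at least $d$; $A_q(v,d;k)$ is the maximum $N$ of such a code. $\tau(U)$ denotes the unique $k\times v$ matrix in reduced row echelon form whose row space is $U$; for a matrix $X$ of full row rank, $\tau^{-1}(X)$ denotes its row space. $A\mid B$ denotes horizontal concatenation of matrices. The rank distance of matrices is $d_R(X,Y)=\mathrm{rk}(X-Y)$. $M(q,a,b,d)=\lceil q^{\max\{a,b\}(\min\{a,b\}-d+1)}\rceil$ is the maximum size of a set of $a\times b$ matrices over $\mathbb{F}_q$ with pairwise rank distance at least $d$. $\Lambda(q,a,b,d,u)$ is the maximum size of a set of $a\times b$ matrices over $\mathbb{F}_q$ with pairwise rank distance at least $d$ in which every matrix has rank at most $u$. Matrices with zero rows or zero columns are allowed; a set consisting of one such (empty) matrix has cardinality one. *)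

theory Defs
  imports
    "Jordan_Normal_Form.DL_Rank"
    "Jordan_Normal_Form.Gauss_Jordan_Elimination"
    "HOL-Library.Cardinality"
begin

text \<open>
  The field with \<open>q\<close> elements is a type \<open>'a :: {field, finite}\<close> with \<open>q = CARD('a)\<close>;
  subspaces of its \<open>v\<close>-th power are sets of vectors contained in \<open>carrier_vec v\<close>.
\<close>

definition subspace_dim :: "nat \<Rightarrow> 'a::field vec set \<Rightarrow> nat" where
  "subspace_dim v U = vectorspace.dim class_ring (module_vec TYPE('a) v\<lparr>carrier := U\<rparr>)"

text \<open>For subspaces the subtraction on \<^typ>\<open>nat\<close> does not truncate.\<close>

definition subspace_dist :: "nat \<Rightarrow> 'a::field vec set \<Rightarrow> 'a vec set \<Rightarrow> nat" where
  "subspace_dist v U W =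
     subspace_dim v (module.submodule_sum (module_vec TYPE('a) v) U W) - subspace_dim v (U \<inter> W)"

definition is_cdc :: "nat \<Rightarrow> nat \<Rightarrow> nat \<Rightarrow> nat \<Rightarrow> 'a::field vec set set \<Rightarrow> bool" where
  "is_cdc v N d k C \<longleftrightarrow>
     finite C \<and> card C = N \<and>
     (\<forall>U\<in>C. subspace class_ring U (module_vec TYPE('a) v) \<and> subspace_dim v U = k) \<and>
     (\<forall>U\<in>C. \<forall>W\<in>C. U \<noteq> W \<longrightarrow> d \<le> subspace_dist v U W)"

definition max_cdc :: "'a::{field,finite} itself \<Rightarrow> nat \<Rightarrow> nat \<Rightarrow> nat \<Rightarrow> nat" where
  "max_cdc (_ :: 'a itself) v d k = Max {N. \<exists>C :: 'a vec set set. is_cdc v N d k C}"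

text \<open>The predicate \<^const>\<open>row_echelon_form\<close> describes the \<^emph>\<open>reduced\<close> row echelon form.\<close>

definition tau :: "nat \<Rightarrow> 'a::field vec set \<Rightarrow> 'a mat" where
  "tau v U = (THE X. X \<in> carrier_mat (subspace_dim v U) v \<and> row_echelon_form X \<and>
                     vec_space.row_space v X = U)"

definition tau_inv :: "'a::field mat \<Rightarrow> 'a vec set" where
  "tau_inv X = vec_space.row_space (dim_col X) X"

definition append_cols :: "'a::zero mat \<Rightarrow> 'a mat \<Rightarrow> 'a mat" (infixr \<open>@\<^sub>c\<close> 65) where
  "A @\<^sub>c B = four_block_mat A B (0\<^sub>m 0 (dim_col A)) (0\<^sub>m 0 (dim_col B))"

definition mat_rank :: "'a::field mat \<Rightarrow> nat" where
  "mat_rank X = vec_space.rank (dim_row X) X"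

definition rank_dist :: "'a::field mat \<Rightarrow> 'a mat \<Rightarrow> nat" where
  "rank_dist X Y = mat_rank (X - Y)"

definition rank_metric_code :: "nat \<Rightarrow> nat \<Rightarrow> nat \<Rightarrow> 'a::field mat set \<Rightarrow> bool" where
  "rank_metric_code a b d C \<longleftrightarrow>
     C \<subseteq> carrier_mat a b \<and> (\<forall>X\<in>C. \<forall>Y\<in>C. X \<noteq> Y \<longrightarrow> d \<le> rank_dist X Y)"

text \<open>The exponent is an integer and may be negative, in which case the value is 1.\<close>

definition mrd_size :: "nat \<Rightarrow> nat \<Rightarrow> nat \<Rightarrow> nat \<Rightarrow> nat" where
  "mrd_size q a b d =
     nat \<lceil>real q powi (int (max a b) * (int (min a b) - int d + 1))\<rceil>"

definition max_bounded_rank_code ::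
    "'a::{field,finite} itself \<Rightarrow> nat \<Rightarrow> nat \<Rightarrow> nat \<Rightarrow> nat \<Rightarrow> nat" where
  "max_bounded_rank_code (_ :: 'a itself) a b d u =
     Max {card C | C :: 'a mat set. rank_metric_code a b d C \<and> (\<forall>X\<in>C. mat_rank X \<le> u)}"

end

theory Submission
  imports "HOL-Algebra.Algebraic_Closure_Type" Defs
begin

text \<open>
  Over a field with \<open>q\<close> elements a subspace of dimension \<open>n\<close> has \<open>q\<^sup>n\<close> elements, so dimensions and
  ranks are read off cardinalities, and two \<open>k\<close>-dimensional codewords have subspace distance at
  least \<open>2e\<close> iff they meet in at most \<open>q\<^bsup>k-e\<^esup>\<close> vectors.

  Projecting \<open>\<tau>\<^sup>-\<^sup>1(\<tau>(A) | M)\<close> to the first \<open>r\<close> coordinates is injective, since \<open>\<tau>(A)\<close> has full row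
  rank. Hence codewords with different \<open>A\<close> meet in no more vectors than the two spaces \<open>A\<close> do, and
  codewords with equal \<open>A\<close> meet in a copy of the left kernel of \<open>M - M'\<close>. The second family is
  treated in the same way with the last \<open>s + t\<close> coordinates. A codeword of the first family meets
  \<open>\<tau>\<^sup>-\<^sup>1(R | \<tau>(B))\<close> in a space that embeds, under the same projection, into the row space of \<open>R\<close>
  followed by the first \<open>t\<close> columns of \<open>\<tau>(B)\<close>; that matrix has rank at most
  \<open>(k - e - t) + t = k - e\<close>.

  For the numerical bound one inserts optimal codes. The rank-metric codes of size \<open>M(q,k,s,e)\<close> are
  Delsarte--Gabidulin codes, built inside the algebraic closure: \<open>{x. x\<^bsup>q^n\<^esup> = x}\<close> is an
  \<open>n\<close>-dimensional space over the ground field, and a nonzero linearized polynomial of \<open>q\<close>-degree less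
  than \<open>K\<close> has at most \<open>q\<^bsup>K-1\<^esup>\<close> roots.
\<close>


unbundle no fps_syntax

section \<open>Counting subspaces over a finite field\<close>

text \<open>\<open>S\<close> is partitioned by the fibres of \<open>f\<close>. With \<open>f\<close>
  the addition of vectors this gives the dimension formula, with \<open>f\<close> a matrix it gives
  rank-nullity.\<close>

lemma card_eq_card_image_times_fibre:
  assumes "finite S" and "\<And>y. y \<in> f ` S \<Longrightarrow> card {x \<in> S. f x = y} = c"
  shows "card S = card (f ` S) * c"
proof -
  have "card S = (\<Sum>y\<in>f ` S. card {x \<in> S. f x = y})"
    using sum.image_gen[OF assms(1), of "\<lambda>_. 1::nat" f] by simp
  then show ?thesis using assms(2) by simp
qed

lemma carrier_vec_finite_field:
  "finite (carrier_vec n :: 'a::finite vec set)"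
  "card (carrier_vec n :: 'a::finite vec set) = CARD('a) ^ n"
proof -
  have bij: "bij_betw list_of_vec (carrier_vec n :: 'a vec set) {xs. set xs \<subseteq> UNIV \<and> length xs = n}"
    by (rule bij_betwI[where g = vec_of_list]) (auto simp only: vec_list list_vec carrier_vec_def
        length_list_of_vec dim_vec_of_list Pi_iff mem_Collect_eq subset_UNIV simp_thms)
  show "finite (carrier_vec n :: 'a vec set)"
    using bij_betw_finite[OF bij] finite_lists_length_eq[of "UNIV :: 'a set" n] by simp
  show "card (carrier_vec n :: 'a vec set) = CARD('a) ^ n"
    using bij_betw_same_card[OF bij] card_lists_length_eq[of "UNIV :: 'a set" n] by simp
qed

lemma finite_carrier_mat: "finite (carrier_mat nr nc :: 'a::finite mat set)"
proof (rule finite_surj)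
  show "finite {xs. set xs \<subseteq> (carrier_vec nc :: 'a vec set) \<and> length xs = nr}"
    by (rule finite_lists_length_eq) (rule carrier_vec_finite_field)
  show "(carrier_mat nr nc :: 'a mat set) \<subseteq> mat_of_rows nc ` {xs. set xs \<subseteq> carrier_vec nc \<and> length xs = nr}"
  proof
    fix A :: "'a mat" assume A: "A \<in> carrier_mat nr nc"
    then have "A = mat_of_rows nc (rows A)" using mat_of_rows_rows[of A] by simp
    moreover have "set (rows A) \<subseteq> carrier_vec nc" "length (rows A) = nr"
      using A by (auto simp: rows_def)
    ultimately show "A \<in> mat_of_rows nc ` {xs. set xs \<subseteq> carrier_vec nc \<and> length xs = nr}"
      by blast
  qed
qed

lemma subspace_vec_iff:
  "subspace class_ring U (module_vec TYPE('a::field) v) \<longleftrightarrow>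
     U \<subseteq> carrier_vec v \<and> 0\<^sub>v v \<in> U \<and> (\<forall>x\<in>U. \<forall>y\<in>U. x + y \<in> U) \<and>
     (\<forall>c. \<forall>x\<in>U. c \<cdot>\<^sub>v x \<in> U)"
proof -
  have "vectorspace (class_ring :: 'a ring) (module_vec TYPE('a) v)" by (rule vec_vs)
  then show ?thesis
    using vec_module[where 'a='a and n=v]
    by (auto simp: subspace_def submodule_def module_vec_simps)
qed

text \<open>Taking coordinates with respect to a basis \<open>b\<close> identifies \<open>U\<close>
  with the functions on \<open>b\<close>; the basis vectors, listed as rows, form the required
  matrix.\<close>

lemma
  fixes U :: "'a::{field,finite} vec set"
  assumes U: "subspace class_ring U (module_vec TYPE('a) v)"
  shows card_subspace: "card U = CARD('a) ^ subspace_dim v U"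
    and subspace_basis_mat: "\<exists>B. B \<in> carrier_mat (subspace_dim v U) v \<and> vec_space.row_space v B = U"
proof -
  interpret vec_space "TYPE('a)" v .
  have sub: "submodule class_ring U V" using U by (simp add: subspace_def)
  have Uc: "U \<subseteq> carrier_vec v" using U by (simp add: subspace_vec_iff)
  have finU: "finite U" using Uc carrier_vec_finite_field(1) by (rule finite_subset)
  interpret W: vectorspace class_ring "vs U"
    using subspace_is_vs U by blast
  have "U \<subseteq> W.span U" using W.in_own_span by auto
  moreover have "W.span U \<subseteq> U" using W.span_is_subset2[of U] by auto
  ultimately have gen: "W.span U = U" by blast
  \<comment> \<open>\<open>U\<close> is finite and spans itself, so it serves as the finite
    generating set.\<close>
  have fd: "W.fin_dim" unfolding W.fin_dim_def using finU gen by auto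
  then obtain b where b: "finite b" "W.basis b" using W.finite_basis_exists by blast
  have bU: "b \<subseteq> U" and spb: "W.span b = U" using b(2) by (auto simp: W.basis_def)
  have dim: "subspace_dim v U = card b"
    unfolding subspace_dim_def using W.dim_basis[OF b] by simp
  have uniq: "\<exists>!a. a \<in> b \<rightarrow>\<^sub>E UNIV \<and> W.lincomb a b = u" if "u \<in> U" for u
    using W.basis_criterion[OF b(1)] bU b(2) that by simp
  have "bij_betw (\<lambda>a. W.lincomb a b) (b \<rightarrow>\<^sub>E UNIV) U"
  proof (rule bij_betw_imageI)
    have mem: "W.lincomb a b \<in> U" for a
      using W.lincomb_closed[of b a] bU by auto
    show "inj_on (\<lambda>a. W.lincomb a b) (b \<rightarrow>\<^sub>E UNIV)"
      using uniq[OF mem] by (intro inj_onI) metis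
    show "(\<lambda>a. W.lincomb a b) ` (b \<rightarrow>\<^sub>E UNIV) = U"
      using uniq mem by (fastforce simp: image_iff)
  qed
  then have "card U = card (b \<rightarrow>\<^sub>E (UNIV :: 'a set))" by (simp add: bij_betw_same_card)
  also have "\<dots> = CARD('a) ^ card b" using b(1) by (simp add: card_PiE)
  finally show "card U = CARD('a) ^ subspace_dim v U" by (simp add: dim)
  obtain xs where xs: "set xs = b" "distinct xs" using finite_distinct_list[OF b(1)] by blast
  \<comment> \<open>The basis spans inside \<open>vs U\<close>; the span is carried over to the
    ambient space, where \<open>row_space\<close> lives.\<close>
  have "span b = U"
    using module.span_li_not_depend(1)[OF _ bU sub] spb vec_module[where 'a='a and n=v] by simp
  then have "mat_of_rows v xs \<in> carrier_mat (subspace_dim v U) v \<and> row_space (mat_of_rows v xs) = U"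
    using xs bU Uc by (auto simp: row_space_def dim distinct_card)
  then show "\<exists>B. B \<in> carrier_mat (subspace_dim v U) v \<and> row_space B = U" by blast
qed

text \<open>As 0 and 1 differ, powers of q are strictly increasing, so comparing cardinalities of
  subspaces amounts to comparing dimensions.\<close>

lemma CARD_field_gt_1: "CARD('a::{field,finite}) > 1"
proof -
  have "card {0, 1 :: 'a} \<le> CARD('a)" by (rule card_mono) auto
  then show ?thesis by simp
qed

lemma subspace_dim_le_iff:
  fixes U :: "'a::{field,finite} vec set"
  assumes "subspace class_ring U (module_vec TYPE('a) v)"
  shows "subspace_dim v U \<le> m \<longleftrightarrow> card U \<le> CARD('a) ^ m"
  using CARD_field_gt_1[where 'a='a] by (simp add: card_subspace[OF assms])

lemma subspace_dim_eq_iff: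
  fixes U :: "'a::{field,finite} vec set"
  assumes "subspace class_ring U (module_vec TYPE('a) v)"
  shows "subspace_dim v U = m \<longleftrightarrow> card U = CARD('a) ^ m"
  using CARD_field_gt_1[where 'a='a] by (simp add: card_subspace[OF assms])

section \<open>Sums, intersections and the subspace distance\<close>

lemma subspace_diff_closed:
  assumes "subspace class_ring U (module_vec TYPE('a::field) v)" "x \<in> U" "y \<in> U"
  shows "x - y \<in> U"
proof -
  have "x + (-1) \<cdot>\<^sub>v y \<in> U" "x \<in> carrier_vec v" "y \<in> carrier_vec v"
    using assms by (auto simp: subspace_vec_iff)
  moreover from this have "x + (-1) \<cdot>\<^sub>v y = x - y" by (intro eq_vecI) auto
  ultimately show ?thesis by simp
qed

lemma subspace_Int:
  assumes "subspace class_ring U (module_vec TYPE('a::field) v)"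
    and "subspace class_ring W (module_vec TYPE('a) v)"
  shows "subspace class_ring (U \<inter> W) (module_vec TYPE('a) v)"
  using assms by (auto simp: subspace_vec_iff)

lemma submodule_sum_vec:
  "module.submodule_sum (module_vec TYPE('a::field) v) U W = (\<lambda>(x, y). x + y) ` (U \<times> W)"
  using module.submodule_sum_def[OF vec_module[where 'a='a and n=v]]
  by (auto simp: module_vec_simps image_def)

lemma subspace_sum:
  assumes U: "subspace class_ring U (module_vec TYPE('a::field) v)"
    and W: "subspace class_ring W (module_vec TYPE('a) v)"
  shows "subspace class_ring (module.submodule_sum (module_vec TYPE('a) v) U W) (module_vec TYPE('a) v)"
  unfolding subspace_vec_iff submodule_sum_vec
proof (intro conjI ballI allI)
  have c: "U \<subseteq> carrier_vec v" "W \<subseteq> carrier_vec v" using U W by (auto simp: subspace_vec_iff)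
  show "(\<lambda>(x, y). x + y) ` (U \<times> W) \<subseteq> carrier_vec v"
    using c by (auto intro!: add_carrier_vec)
  show "0\<^sub>v v \<in> (\<lambda>(x, y). x + y) ` (U \<times> W)"
    using U W by (intro image_eqI[where x = "(0\<^sub>v v, 0\<^sub>v v)"]) (auto simp: subspace_vec_iff)
  fix a assume "a \<in> (\<lambda>(x, y). x + y) ` (U \<times> W)"
  then obtain x y where a: "a = x + y" "x \<in> U" "y \<in> W" by auto
  then have xy: "x \<in> carrier_vec v" "y \<in> carrier_vec v" using c by auto
  show "k \<cdot>\<^sub>v a \<in> (\<lambda>(x, y). x + y) ` (U \<times> W)" for k
    using U W a xy
    by (intro image_eqI[where x = "(k \<cdot>\<^sub>v x, k \<cdot>\<^sub>v y)"]) (auto simp: subspace_vec_iff smult_add_distrib_vec)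
  fix b assume "b \<in> (\<lambda>(x, y). x + y) ` (U \<times> W)"
  then obtain x' y' where b: "b = x' + y'" "x' \<in> U" "y' \<in> W" by auto
  then have xy': "x' \<in> carrier_vec v" "y' \<in> carrier_vec v" using c by auto
  have "a + b = (x + x') + (y + y')" unfolding a b using xy xy' by (intro eq_vecI) auto
  then show "a + b \<in> (\<lambda>(x, y). x + y) ` (U \<times> W)"
    using U W a b by (intro image_eqI[where x = "(x + x', y + y')"]) (auto simp: subspace_vec_iff)
qed

text \<open>The dimension formula in multiplicative form: the fibre of addition through (x, y)
  consists of the pairs (x + w, y - w) with \<open>w\<close> in \<open>U \<inter> W\<close>.\<close>

lemma card_subspace_sum:
  fixes U W :: "'a::{field,finite} vec set"
  assumes U: "subspace class_ring U (module_vec TYPE('a) v)"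
    and W: "subspace class_ring W (module_vec TYPE('a) v)"
  shows "card U * card W =
    card (module.submodule_sum (module_vec TYPE('a) v) U W) * card (U \<inter> W)"
proof -
  have c: "U \<subseteq> carrier_vec v" "W \<subseteq> carrier_vec v" using U W by (auto simp: subspace_vec_iff)
  then have fin: "finite U" "finite W" using carrier_vec_finite_field(1) finite_subset by blast+
  have "card {p \<in> U \<times> W. (\<lambda>(x, y). x + y) p = z} = card (U \<inter> W)"
    if z: "z \<in> (\<lambda>(x, y). x + y) ` (U \<times> W)" for z
  proof -
    obtain x y where xy: "z = x + y" "x \<in> U" "y \<in> W" using z by auto
    then have cxy: "x \<in> carrier_vec v" "y \<in> carrier_vec v" using c by auto
    have "bij_betw (\<lambda>w. (x + w, y - w)) (U \<inter> W) {p \<in> U \<times> W. (\<lambda>(x, y). x + y) p = z}"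
    proof (rule bij_betwI[where g = "\<lambda>(a, b). a - x"])
      show "(\<lambda>w. (x + w, y - w)) \<in> U \<inter> W \<rightarrow> {p \<in> U \<times> W. (\<lambda>(x, y). x + y) p = z}"
      proof
        fix w assume w: "w \<in> U \<inter> W"
        then have cw: "w \<in> carrier_vec v" using c by auto
        have "x + w + (y - w) = z" unfolding xy using cxy cw by (intro eq_vecI) auto
        then show "(x + w, y - w) \<in> {p \<in> U \<times> W. (\<lambda>(x, y). x + y) p = z}"
          using w xy U subspace_diff_closed[OF W xy(3)] by (auto simp: subspace_vec_iff)
      qed
      show "(\<lambda>(a, b). a - x) \<in> {p \<in> U \<times> W. (\<lambda>(x, y). x + y) p = z} \<rightarrow> U \<inter> W"
      proof
        fix p assume "p \<in> {p \<in> U \<times> W. (\<lambda>(x, y). x + y) p = z}"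
        then obtain a b where p: "p = (a, b)" "a \<in> U" "b \<in> W" "a + b = x + y" using xy by auto
        then have cab: "a \<in> carrier_vec v" "b \<in> carrier_vec v" using c by auto
        \<comment> \<open>The left side lies in \<open>U\<close> and the right side in
          \<open>W\<close>, so the common value lies in \<open>U \<inter> W\<close>.\<close>
        have "a - x = y - b"
        proof (rule eq_vecI)
          show "dim_vec (a - x) = dim_vec (y - b)" using cab cxy by auto
          fix i assume "i < dim_vec (y - b)"
          then have i: "i < v" using cab by auto
          have "(a + b) $ i = (x + y) $ i" using p by simp
          then have "a $ i + b $ i = x $ i + y $ i" using i cab cxy by simp
          then show "(a - x) $ i = (y - b) $ i" using i cab cxy by (simp add: algebra_simps)
        qed
        then show "(\<lambda>(a, b). a - x) p \<in> U \<inter> W"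
          using subspace_diff_closed[OF U p(2) xy(2)] subspace_diff_closed[OF W xy(3) p(3)] p by auto
      qed
      show "(\<lambda>(a, b). a - x) ((x + w, y - w)) = w" if "w \<in> U \<inter> W" for w
      proof -
        have "w \<in> carrier_vec v" using that c by auto
        then have "x + w - x = w" using cxy by (intro eq_vecI) auto
        then show ?thesis by simp
      qed
      fix p assume "p \<in> {p \<in> U \<times> W. (\<lambda>(x, y). x + y) p = z}"
      then obtain a b where p: "p = (a, b)" "a \<in> U" "b \<in> W" "a + b = x + y" using xy by auto
      then have cab: "a \<in> carrier_vec v" "b \<in> carrier_vec v" using c by auto
      have "y - (a - x) = b"
      proof (rule eq_vecI)
        show "dim_vec (y - (a - x)) = dim_vec b" using cab cxy by auto
        fix i assume "i < dim_vec b"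
        then have i: "i < v" using cab by auto
        have "(a + b) $ i = (x + y) $ i" using p by simp
        then have "a $ i + b $ i = x $ i + y $ i" using i cab cxy by simp
        then show "(y - (a - x)) $ i = b $ i" using i cab cxy by (simp add: algebra_simps)
      qed
      moreover have "x + (a - x) = a" using cab cxy by (intro eq_vecI) auto
      ultimately show "(\<lambda>w. (x + w, y - w)) ((\<lambda>(a, b). a - x) p) = p" using p by simp
    qed
    then show ?thesis by (simp add: bij_betw_same_card)
  qed
  from card_eq_card_image_times_fibre[OF _ this] fin
  show ?thesis by (simp add: submodule_sum_vec card_cartesian_product)
qed

text \<open>For two \<open>k\<close>-dimensional spaces the distance is 2k minus twice the dimension
  of the intersection. The assumption \<open>e \<le> k\<close> keeps \<open>k - e\<close> from
  truncating.\<close>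

lemma subspace_dist_ge_iff:
  fixes U W :: "'a::{field,finite} vec set"
  assumes U: "subspace class_ring U (module_vec TYPE('a) v)" "subspace_dim v U = k"
    and W: "subspace class_ring W (module_vec TYPE('a) v)" "subspace_dim v W = k"
    and "e \<le> k"
  shows "2 * e \<le> subspace_dist v U W \<longleftrightarrow> card (U \<inter> W) \<le> CARD('a) ^ (k - e)"
proof -
  let ?S = "module.submodule_sum (module_vec TYPE('a) v) U W"
  have I: "subspace class_ring (U \<inter> W) (module_vec TYPE('a) v)"
    by (rule subspace_Int[OF U(1) W(1)])
  have "CARD('a) ^ (k + k) = CARD('a) ^ (subspace_dim v ?S + subspace_dim v (U \<inter> W))"
    using card_subspace_sum[OF U(1) W(1)]
    unfolding card_subspace[OF U(1)] card_subspace[OF W(1)] card_subspace[OF I]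
      card_subspace[OF subspace_sum[OF U(1) W(1)]] U(2) W(2)
    by (simp only: power_add)
  then have "k + k = subspace_dim v ?S + subspace_dim v (U \<inter> W)"
    using CARD_field_gt_1[where 'a='a] by simp
  \<comment> \<open>With this bound the subtraction in \<open>subspace_dist\<close> does not
    truncate either.\<close>
  moreover have "subspace_dim v (U \<inter> W) \<le> k"
    unfolding subspace_dim_le_iff[OF I] U(2)[symmetric] card_subspace[OF U(1), symmetric]
    using U(1) carrier_vec_finite_field(1)
    by (intro card_mono) (auto simp: subspace_vec_iff intro: finite_subset)
  ultimately have "2 * e \<le> subspace_dist v U W \<longleftrightarrow> subspace_dim v (U \<inter> W) \<le> k - e"
    unfolding subspace_dist_def using \<open>e \<le> k\<close> by arith
  then show ?thesis using subspace_dim_le_iff[OF I] by simp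
qed

section \<open>Ranks of matrices over a finite field\<close>

lemma range_mult_mat_vec_subspace:
  assumes A: "A \<in> carrier_mat m n"
  shows "subspace class_ring ((\<lambda>x. A *\<^sub>v x) ` carrier_vec n) (module_vec TYPE('a::field) m)"
  unfolding subspace_vec_iff
proof (intro conjI ballI allI)
  show "(\<lambda>x. A *\<^sub>v x) ` carrier_vec n \<subseteq> carrier_vec m" using A by auto
  have "A *\<^sub>v 0\<^sub>v n = 0\<^sub>v m" using A by auto
  then show "0\<^sub>v m \<in> (\<lambda>x. A *\<^sub>v x) ` carrier_vec n" by (metis imageI zero_carrier_vec)
  fix a assume "a \<in> (\<lambda>x. A *\<^sub>v x) ` carrier_vec n"
  then obtain x where x: "a = A *\<^sub>v x" "x \<in> carrier_vec n" by auto
  show "c \<cdot>\<^sub>v a \<in> (\<lambda>x. A *\<^sub>v x) ` carrier_vec n" for c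
    using A x by (intro image_eqI[where x = "c \<cdot>\<^sub>v x"]) (auto simp: mult_mat_vec)
  fix b assume "b \<in> (\<lambda>x. A *\<^sub>v x) ` carrier_vec n"
  then obtain y where y: "b = A *\<^sub>v y" "y \<in> carrier_vec n" by auto
  then show "a + b \<in> (\<lambda>x. A *\<^sub>v x) ` carrier_vec n"
    using A x by (intro image_eqI[where x = "x + y"]) (auto simp: mult_add_distrib_mat_vec)
qed

lemma col_space_eq_range:
  assumes "A \<in> carrier_mat m n"
  shows "vec_space.col_space m A = (\<lambda>x. A *\<^sub>v x) ` carrier_vec n"
  using assms by (auto simp: vec_space.col_space_eq[OF assms])

lemma row_space_eq_range:
  assumes "A \<in> carrier_mat m n"
  shows "vec_space.row_space n A = (\<lambda>x. A\<^sup>T *\<^sub>v x) ` carrier_vec m"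
  using assms by (auto simp: vec_space.row_space_eq[OF assms])

lemma tau_inv_eq_range:
  assumes "A \<in> carrier_mat m n"
  shows "tau_inv A = (\<lambda>x. A\<^sup>T *\<^sub>v x) ` carrier_vec m"
  using row_space_eq_range[OF assms] assms by (simp add: tau_inv_def)

lemma card_range_mult_mat_vec:
  assumes A: "(A :: 'a::{field,finite} mat) \<in> carrier_mat m n"
  shows "card ((\<lambda>x. A *\<^sub>v x) ` carrier_vec n) = CARD('a) ^ mat_rank A"
proof -
  have "mat_rank A = subspace_dim m (vec_space.col_space m A)"
    using A by (simp add: mat_rank_def subspace_dim_def vec_space.rank_def vec_space.col_space_def)
  then show ?thesis
    using card_subspace[OF range_mult_mat_vec_subspace[OF A]] by (simp add: col_space_eq_range[OF A])
qed

text \<open>Rank-nullity as a count: every nonempty fibre of the map given by \<open>A\<close> is a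
  translate of the kernel.\<close>

lemma card_kernel_times_card_range:
  assumes A: "(A :: 'a::{field,finite} mat) \<in> carrier_mat m n"
  shows "CARD('a) ^ n = CARD('a) ^ mat_rank A * card {x \<in> carrier_vec n. A *\<^sub>v x = 0\<^sub>v m}"
proof -
  have "card {x \<in> carrier_vec n. A *\<^sub>v x = y} = card {x \<in> carrier_vec n. A *\<^sub>v x = 0\<^sub>v m}"
    if y: "y \<in> (\<lambda>x. A *\<^sub>v x) ` carrier_vec n" for y
  proof -
    obtain z where z: "y = A *\<^sub>v z" "z \<in> carrier_vec n" using y by auto
    have "bij_betw (\<lambda>x. x - z) {x \<in> carrier_vec n. A *\<^sub>v x = y} {x \<in> carrier_vec n. A *\<^sub>v x = 0\<^sub>v m}"
    proof (rule bij_betwI[where g = "\<lambda>x. x + z"])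
      show "(\<lambda>x. x - z) \<in> {x \<in> carrier_vec n. A *\<^sub>v x = y} \<rightarrow> {x \<in> carrier_vec n. A *\<^sub>v x = 0\<^sub>v m}"
        using z A by (auto simp: mult_minus_distrib_mat_vec)
      show "(\<lambda>x. x + z) \<in> {x \<in> carrier_vec n. A *\<^sub>v x = 0\<^sub>v m} \<rightarrow> {x \<in> carrier_vec n. A *\<^sub>v x = y}"
        using z A by (auto simp: mult_add_distrib_mat_vec)
      show "x - z + z = x" if "x \<in> {x \<in> carrier_vec n. A *\<^sub>v x = y}" for x
        using that z by (intro eq_vecI) auto
      show "x + z - z = x" if "x \<in> {x \<in> carrier_vec n. A *\<^sub>v x = 0\<^sub>v m}" for x
        using that z by (intro eq_vecI) auto
    qed
    then show ?thesis by (rule bij_betw_same_card)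
  qed
  from card_eq_card_image_times_fibre[OF carrier_vec_finite_field(1) this]
  show ?thesis by (simp add: carrier_vec_finite_field(2) card_range_mult_mat_vec[OF A])
qed

lemma mat_rank_le_dim_col:
  assumes A: "(A :: 'a::{field,finite} mat) \<in> carrier_mat m n"
  shows "mat_rank A \<le> n"
proof -
  have "card ((\<lambda>x. A *\<^sub>v x) ` carrier_vec n) \<le> card (carrier_vec n :: 'a vec set)"
    by (intro card_image_le carrier_vec_finite_field(1))
  then show ?thesis
    using CARD_field_gt_1[where 'a='a]
    by (simp add: card_range_mult_mat_vec[OF A] carrier_vec_finite_field(2))
qed

lemma card_kernel_mat:
  assumes A: "(A :: 'a::{field,finite} mat) \<in> carrier_mat m n"
  shows "card {x \<in> carrier_vec n. A *\<^sub>v x = 0\<^sub>v m} = CARD('a) ^ (n - mat_rank A)"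
proof -
  have "CARD('a) ^ mat_rank A * CARD('a) ^ (n - mat_rank A) = CARD('a) ^ n"
    using mat_rank_le_dim_col[OF A] by (simp add: power_add[symmetric])
  with card_kernel_times_card_range[OF A] show ?thesis by simp
qed

text \<open>A matrix of rank \<open>r\<close> factors through \<open>r\<close>-dimensional space, which bounds the rank of its
  transpose.\<close>

lemma mat_rank_transpose_le:
  assumes A: "(A :: 'a::{field,finite} mat) \<in> carrier_mat m n"
  shows "mat_rank A\<^sup>T \<le> mat_rank A"
proof -
  let ?U = "(\<lambda>x. A *\<^sub>v x) ` carrier_vec n"
  have U: "subspace class_ring ?U (module_vec TYPE('a) m)"
    by (rule range_mult_mat_vec_subspace[OF A])
  have r: "subspace_dim m ?U = mat_rank A"
    unfolding subspace_dim_eq_iff[OF U] by (rule card_range_mult_mat_vec[OF A])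
  obtain B where B: "B \<in> carrier_mat (mat_rank A) m" "vec_space.row_space m B = ?U"
    using subspace_basis_mat[OF U] unfolding r by blast
  have "\<exists>c. c \<in> carrier_vec (mat_rank A) \<and> B\<^sup>T *\<^sub>v c = col A j" if j: "j < n" for j
  proof -
    have "A *\<^sub>v unit_vec n j \<in> ?U" by simp
    moreover have "A *\<^sub>v unit_vec n j = col A j"
      using A j by (intro eq_vecI) auto
    ultimately show ?thesis using B(2) unfolding row_space_eq_range[OF B(1)] by (metis imageE)
  qed
  then obtain c where c: "\<And>j. j < n \<Longrightarrow> c j \<in> carrier_vec (mat_rank A) \<and> B\<^sup>T *\<^sub>v c j = col A j"
    by metis
  \<comment> \<open>Column \<open>j\<close> of \<open>C\<close> holds the coordinates of column
    \<open>j\<close> of \<open>A\<close> with respect to the rows of \<open>B\<close>, which span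
    the column space of \<open>A\<close>.\<close>
  define C where "C = mat_of_cols (mat_rank A) (map c [0..<n])"
  have C: "C \<in> carrier_mat (mat_rank A) n" unfolding C_def by auto
  have "A = B\<^sup>T * C"
  proof (rule eq_matI)
    fix i j assume ij: "i < dim_row (B\<^sup>T * C)" "j < dim_col (B\<^sup>T * C)"
    then have j: "i < m" "j < n" using B C by auto
    have "col C j = c j" unfolding C_def using j c[of j] by (simp add: col_mat_of_cols)
    then have "(B\<^sup>T * C) $$ (i, j) = (B\<^sup>T *\<^sub>v c j) $ i" using ij B C by simp
    then show "A $$ (i, j) = (B\<^sup>T * C) $$ (i, j)" using c[of j] j A by simp
  qed (use A B C in auto)
  then have At: "A\<^sup>T = C\<^sup>T * B"
    using B C by (simp add: transpose_mult[of _ m "mat_rank A" _ n])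
  \<comment> \<open>The range of the transpose of \<open>A\<close> lies in that of the transpose of
    \<open>C\<close>, a map on a space with only q^rank(A) elements.\<close>
  have "(\<lambda>x. A\<^sup>T *\<^sub>v x) ` carrier_vec m \<subseteq> (\<lambda>x. C\<^sup>T *\<^sub>v x) ` carrier_vec (mat_rank A)"
  proof
    fix y assume "y \<in> (\<lambda>x. A\<^sup>T *\<^sub>v x) ` carrier_vec m"
    then obtain x where x: "x \<in> carrier_vec m" "y = A\<^sup>T *\<^sub>v x" by auto
    then have "y = C\<^sup>T *\<^sub>v (B *\<^sub>v x)" unfolding At using B C by (simp add: assoc_mult_mat_vec[of _ n "mat_rank A"])
    then show "y \<in> (\<lambda>x. C\<^sup>T *\<^sub>v x) ` carrier_vec (mat_rank A)" using B x by auto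
  qed
  then have "card ((\<lambda>x. A\<^sup>T *\<^sub>v x) ` carrier_vec m) \<le> card ((\<lambda>x. C\<^sup>T *\<^sub>v x) ` carrier_vec (mat_rank A))"
    by (intro card_mono finite_imageI carrier_vec_finite_field(1))
  also have "\<dots> \<le> card (carrier_vec (mat_rank A) :: 'a vec set)"
    by (intro card_image_le carrier_vec_finite_field(1))
  finally show ?thesis
    using CARD_field_gt_1[where 'a='a] A
    by (simp add: card_range_mult_mat_vec[of _ n m] carrier_vec_finite_field(2))
qed

lemma mat_rank_transpose: "mat_rank (A :: 'a::{field,finite} mat)\<^sup>T = mat_rank A"
  using mat_rank_transpose_le[of A "dim_row A" "dim_col A"]
    mat_rank_transpose_le[of "A\<^sup>T" "dim_col A" "dim_row A"] by simp

section \<open>Uniqueness of the reduced row echelon form\<close>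

text \<open>A pivot column is a unit vector, so position \<open>f i\<close> of a combination of rows
  shows the coefficient of row \<open>i\<close>.\<close>

lemma pivot_fun_mult_vec:
  assumes Z: "Z \<in> carrier_mat k v" and f: "pivot_fun Z f v" and y: "y \<in> carrier_vec k"
    and i: "i < k" "f i < v"
  shows "(Z\<^sup>T *\<^sub>v y) $ f i = (y :: 'a::field vec) $ i"
proof -
  have "(Z\<^sup>T *\<^sub>v y) $ f i = (\<Sum>l = 0..<k. Z $$ (l, f i) * y $ l)"
    using Z y i by (simp add: scalar_prod_def)
  also have "\<dots> = (\<Sum>l = 0..<k. if l = i then y $ l else 0)"
    using pivot_funD(4,5)[OF _ f, of k] Z i by (intro sum.cong) auto
  finally show ?thesis using i by simp
qed

text \<open>The value \<open>v\<close> of a pivot function marks a zero row, and a zero row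
  contradicts independence of the rows, expressed here as injectivity.\<close>

lemma pivot_fun_less:
  fixes Z :: "'a::field mat"
  assumes Z: "Z \<in> carrier_mat k v" and f: "pivot_fun Z f v"
    and inj: "inj_on (\<lambda>x. Z\<^sup>T *\<^sub>v x) (carrier_vec k)" and i: "i < k"
  shows "f i < v"
proof (rule ccontr)
  assume "\<not> f i < v"
  then have "f i = v" using pivot_funD(1)[OF _ f, of k] Z i by fastforce
  then have "Z\<^sup>T *\<^sub>v unit_vec k i = Z\<^sup>T *\<^sub>v 0\<^sub>v k"
    using pivot_funD(2)[OF _ f, of k] Z i by (intro eq_vecI) auto
  then have "unit_vec k i = (0\<^sub>v k :: 'a vec)" using inj by (auto simp: inj_on_def)
  then have "unit_vec k i $ i = (0\<^sub>v k :: 'a vec) $ i" by simp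
  then show False using i by simp
qed

text \<open>\<open>pivot_fun\<close> allows the value \<open>v\<close> as an alternative to strict
  growth; \<open>lt\<close> excludes it.\<close>

lemma pivot_fun_strict_mono:
  assumes Z: "Z \<in> carrier_mat k v" and f: "pivot_fun Z f v"
    and lt: "\<And>i. i < k \<Longrightarrow> f i < v" and "i < j" "j < k"
  shows "f i < f j"
  using \<open>i < j\<close> \<open>j < k\<close>
proof (induction j)
  case (Suc j)
  have "f j < f (Suc j)"
    using pivot_funD(3)[OF _ f, of k j] Z Suc.prems lt[of "Suc j"] by auto
  then show ?case using Suc by (cases "i = j") auto
qed simp

text \<open>A nonzero combination of rows leads at the pivot of the first row that it uses. The
  right side mentions only the row space, so echelon matrices with the same row space have the same
  pivot columns.\<close>

lemma pivot_positions_eq_leading_positions: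
  assumes Z: "Z \<in> carrier_mat k v" and f: "pivot_fun Z f v"
    and inj: "inj_on (\<lambda>x. Z\<^sup>T *\<^sub>v x) (carrier_vec k)"
  shows "f ` {..<k} =
    {j. j < v \<and> (\<exists>w\<in>(\<lambda>x. Z\<^sup>T *\<^sub>v x) ` carrier_vec k. w $ j \<noteq> (0::'a::field) \<and> (\<forall>l<j. w $ l = 0))}"
proof (intro equalityI subsetI)
  note lt = pivot_fun_less[OF Z f inj]
  fix j assume "j \<in> f ` {..<k}"
  then obtain i where i: "i < k" "j = f i" by auto
  let ?w = "Z\<^sup>T *\<^sub>v unit_vec k i"
  have "?w $ j \<noteq> 0" unfolding i(2) using pivot_fun_mult_vec[OF Z f _ i(1) lt[OF i(1)]] i by simp
  moreover have "?w $ l = 0" if "l < j" for l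
    using that pivot_funD(2)[OF _ f, of k i l] Z i lt[OF i(1)] by simp
  ultimately show "j \<in> {j. j < v \<and> (\<exists>w\<in>(\<lambda>x. Z\<^sup>T *\<^sub>v x) ` carrier_vec k. w $ j \<noteq> 0 \<and> (\<forall>l<j. w $ l = 0))}"
    using lt i by auto
next
  note lt = pivot_fun_less[OF Z f inj]
  fix j assume "j \<in> {j. j < v \<and> (\<exists>w\<in>(\<lambda>x. Z\<^sup>T *\<^sub>v x) ` carrier_vec k. w $ j \<noteq> 0 \<and> (\<forall>l<j. w $ l = 0))}"
  then obtain y where y: "y \<in> carrier_vec k" and j: "j < v" "(Z\<^sup>T *\<^sub>v y) $ j \<noteq> 0"
    and lead: "\<And>l. l < j \<Longrightarrow> (Z\<^sup>T *\<^sub>v y) $ l = 0" by auto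
  have sum: "(Z\<^sup>T *\<^sub>v y) $ l = (\<Sum>i = 0..<k. Z $$ (i, l) * y $ i)" if "l < v" for l
    using Z y that by (simp add: scalar_prod_def)
  have "\<exists>i<k. Z $$ (i, j) * y $ i \<noteq> 0"
    using j sum by (metis (no_types, lifting) atLeastLessThan_iff sum.neutral)
  then have ex: "\<exists>i. i < k \<and> y $ i \<noteq> 0" by auto
  \<comment> \<open>Row \<open>i\<close> is the first with a nonzero coefficient: earlier rows do
    not contribute, and the rows from \<open>i\<close> on vanish before column
    \<open>f i\<close>.\<close>
  define i where "i = (LEAST i. i < k \<and> y $ i \<noteq> 0)"
  have i: "i < k" "y $ i \<noteq> 0" using LeastI_ex[OF ex] by (auto simp: i_def)
  have less: "y $ l = 0" if "l < i" for l
    using not_less_Least[of l "\<lambda>i. i < k \<and> y $ i \<noteq> 0"] that i by (auto simp: i_def)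
  have "(Z\<^sup>T *\<^sub>v y) $ f i \<noteq> 0" using pivot_fun_mult_vec[OF Z f y i(1) lt[OF i(1)]] i by simp
  then have "\<not> f i < j" using lead by auto
  moreover have "\<not> j < f i"
  proof
    assume jf: "j < f i"
    have "Z $$ (l, j) * y $ l = 0" if l: "l < k" for l
    proof (cases "l < i")
      case False
      then have "f i \<le> f l"
        using pivot_fun_strict_mono[OF Z f lt, of i l] l by (cases "l = i") auto
      then show ?thesis using pivot_funD(2)[OF _ f, of k l j] Z l jf by auto
    qed (simp add: less)
    then have "(Z\<^sup>T *\<^sub>v y) $ j = 0" unfolding sum[OF j(1)] by (intro sum.neutral) auto
    then show False using j by simp
  qed
  ultimately show "j \<in> f ` {..<k}" using i by auto
qed

text \<open>Both functions enumerate the same finite set in increasing order.\<close>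

lemma strict_mono_on_same_image_eq:
  fixes f g :: "nat \<Rightarrow> nat"
  assumes "\<And>i j. i < j \<Longrightarrow> j < k \<Longrightarrow> f i < f j" "\<And>i j. i < j \<Longrightarrow> j < k \<Longrightarrow> g i < g j"
    and "f ` {..<k} = g ` {..<k}" "i < k"
  shows "f i = g i"
proof -
  have "map f [0..<k] = map g [0..<k]"
  proof (rule strict_sorted_equal)
    show "sorted_wrt (<) (map f [0..<k])" using assms(1) by (simp add: sorted_wrt_iff_nth_less)
    show "sorted_wrt (<) (map g [0..<k])" using assms(2) by (simp add: sorted_wrt_iff_nth_less)
    show "set (map f [0..<k]) = set (map g [0..<k])" using assms(3) by (simp add: atLeast0LessThan)
  qed
  then show ?thesis using \<open>i < k\<close> by simp
qed

text \<open>Equal row spaces give equal pivot columns. Writing a row of \<open>Z\<close> as a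
  combination of rows of \<open>Y\<close> and reading it off at the pivots shows that the
  coefficients form a unit vector.\<close>

lemma row_echelon_form_unique:
  fixes Z Y :: "'a::field mat"
  assumes Z: "Z \<in> carrier_mat k v" "row_echelon_form Z" "inj_on (\<lambda>x. Z\<^sup>T *\<^sub>v x) (carrier_vec k)"
    and Y: "Y \<in> carrier_mat k v" "row_echelon_form Y" "inj_on (\<lambda>x. Y\<^sup>T *\<^sub>v x) (carrier_vec k)"
    and eq: "(\<lambda>x. Z\<^sup>T *\<^sub>v x) ` carrier_vec k = (\<lambda>x. Y\<^sup>T *\<^sub>v x) ` carrier_vec k"
  shows "Z = Y"
proof -
  obtain f where f: "pivot_fun Z f v" using Z by (auto simp: row_echelon_form_def)
  obtain g where g: "pivot_fun Y g v" using Y by (auto simp: row_echelon_form_def)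
  note ltf = pivot_fun_less[OF Z(1) f Z(3)] and ltg = pivot_fun_less[OF Y(1) g Y(3)]
  have "f ` {..<k} = g ` {..<k}"
    unfolding pivot_positions_eq_leading_positions[OF Z(1) f Z(3)]
      pivot_positions_eq_leading_positions[OF Y(1) g Y(3)] eq ..
  then have fg: "f i = g i" if "i < k" for i
    using strict_mono_on_same_image_eq[of k f g i] pivot_fun_strict_mono[OF Z(1) f ltf]
      pivot_fun_strict_mono[OF Y(1) g ltg] that by blast
  have "Z\<^sup>T *\<^sub>v unit_vec k i = Y\<^sup>T *\<^sub>v unit_vec k i" if i: "i < k" for i
  proof -
    have "Z\<^sup>T *\<^sub>v unit_vec k i \<in> (\<lambda>x. Y\<^sup>T *\<^sub>v x) ` carrier_vec k" unfolding eq[symmetric] by simp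
    then obtain y where y: "y \<in> carrier_vec k" "Z\<^sup>T *\<^sub>v unit_vec k i = Y\<^sup>T *\<^sub>v y" by auto
    have "y $ j = unit_vec k i $ j" if j: "j < k" for j
      using pivot_fun_mult_vec[OF Z(1) f _ j ltf[OF j], of "unit_vec k i"]
        pivot_fun_mult_vec[OF Y(1) g y(1) j ltg[OF j]] y(2) fg[OF j] by simp
    then have "y = unit_vec k i" using y(1) by (intro eq_vecI) auto
    then show ?thesis using y(2) by simp
  qed
  then have entry: "(Z\<^sup>T *\<^sub>v unit_vec k i) $ j = (Y\<^sup>T *\<^sub>v unit_vec k i) $ j" if "i < k" for i j
    using that by simp
  have "Z $$ (i, j) = Y $$ (i, j)" if "i < k" "j < v" for i j
    using entry[of i j] that Z(1) Y(1) by simp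
  then show ?thesis using Z(1) Y(1) by (intro eq_matI) auto
qed

lemma inj_on_mult_mat_vec_iff_card:
  assumes Z: "(Z :: 'a::{field,finite} mat) \<in> carrier_mat k v"
  shows "inj_on (\<lambda>x. Z\<^sup>T *\<^sub>v x) (carrier_vec k) \<longleftrightarrow>
    card ((\<lambda>x. Z\<^sup>T *\<^sub>v x) ` carrier_vec k) = CARD('a) ^ k"
  using inj_on_iff_eq_card[OF carrier_vec_finite_field(1), of "\<lambda>x. Z\<^sup>T *\<^sub>v x" k]
  by (simp add: carrier_vec_finite_field(2))

text \<open>The definite description in \<open>tau\<close> is legitimate: Gauss-Jordan elimination
  of a basis matrix gives existence, since an invertible factor keeps the row space. Full row rank
  appears as injectivity of the map from coefficients to combinations of rows.\<close>

lemma tau_spec: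
  fixes U :: "'a::{field,finite} vec set"
  assumes U: "subspace class_ring U (module_vec TYPE('a) v)" and k: "subspace_dim v U = k"
  shows "tau v U \<in> carrier_mat k v"
    and "(\<lambda>x. (tau v U)\<^sup>T *\<^sub>v x) ` carrier_vec k = U"
    and "inj_on (\<lambda>x. (tau v U)\<^sup>T *\<^sub>v x) (carrier_vec k)"
proof -
  let ?P = "\<lambda>Z. Z \<in> carrier_mat (subspace_dim v U) v \<and> row_echelon_form Z \<and> vec_space.row_space v Z = U"
  have inj: "inj_on (\<lambda>x. Z\<^sup>T *\<^sub>v x) (carrier_vec k)" if "?P Z" for Z
    using that card_subspace[OF U] k row_space_eq_range[of Z k v]
    by (subst inj_on_mult_mat_vec_iff_card[of Z k v]) auto
  have "\<exists>!Z. ?P Z"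
  proof (rule ex_ex1I)
    obtain B where B: "B \<in> carrier_mat k v" "vec_space.row_space v B = U"
      using subspace_basis_mat[OF U] k by blast
    define C where "C = gauss_jordan_single B"
    have C: "C \<in> carrier_mat k v" "row_echelon_form C"
      using gauss_jordan_single(2,3)[OF B(1)] by (auto simp: C_def)
    obtain P Q where PQ: "C = P * B" "P \<in> carrier_mat k k" "Q \<in> carrier_mat k k"
        "P * Q = 1\<^sub>m k" "Q * P = 1\<^sub>m k"
      using gauss_jordan_single(4)[OF B(1)] by (auto simp: C_def)
    have "invertible_mat P"
      using PQ unfolding invertible_mat_def inverts_mat_def by auto
    then have "vec_space.row_space v C = U"
      using vec_space.row_space_is_preserved[of P k B v] PQ B by simp
    then show "\<exists>Z. ?P Z" using C k by auto
    show "Z = Y" if "?P Z" "?P Y" for Z Y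
      using that inj[OF that(1)] inj[OF that(2)] k
        row_space_eq_range[of Z k v] row_space_eq_range[of Y k v]
      by (intro row_echelon_form_unique[of Z k v Y]) auto
  qed
  then have P: "?P (tau v U)" unfolding tau_def by (rule theI')
  then show "tau v U \<in> carrier_mat k v" "(\<lambda>x. (tau v U)\<^sup>T *\<^sub>v x) ` carrier_vec k = U"
    using k row_space_eq_range[of "tau v U" k v] by auto
  show "inj_on (\<lambda>x. (tau v U)\<^sup>T *\<^sub>v x) (carrier_vec k)" by (rule inj[OF P])
qed

section \<open>The combined code\<close>

lemma vec_first_append: "x \<in> carrier_vec m \<Longrightarrow> vec_first (x @\<^sub>v y) m = x"
  unfolding vec_first_def by (rule eq_vecI) auto

lemma vec_last_append: "y \<in> carrier_vec m \<Longrightarrow> vec_last (x @\<^sub>v y) m = y"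
  unfolding vec_last_def by (rule eq_vecI) auto

lemma append_cols_carrier:
  "A \<in> carrier_mat k r \<Longrightarrow> B \<in> carrier_mat k s \<Longrightarrow> A @\<^sub>c B \<in> carrier_mat k (r + s)"
  by (auto simp: append_cols_def)

lemma append_cols_transpose_mult_vec:
  assumes A: "A \<in> carrier_mat k r" and B: "B \<in> carrier_mat k s" and x: "x \<in> carrier_vec k"
  shows "(A @\<^sub>c B)\<^sup>T *\<^sub>v x = (A\<^sup>T *\<^sub>v x) @\<^sub>v (B\<^sup>T *\<^sub>v (x :: 'a::field vec))"
proof (rule eq_vecI)
  show "dim_vec ((A @\<^sub>c B)\<^sup>T *\<^sub>v x) = dim_vec ((A\<^sup>T *\<^sub>v x) @\<^sub>v (B\<^sup>T *\<^sub>v x))"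
    using A B append_cols_carrier[OF A B] by auto
  fix i assume "i < dim_vec ((A\<^sup>T *\<^sub>v x) @\<^sub>v (B\<^sup>T *\<^sub>v x))"
  then have i: "i < r + s" using A B by auto
  have "((A @\<^sub>c B)\<^sup>T *\<^sub>v x) $ i = (\<Sum>l = 0..<k. (A @\<^sub>c B) $$ (l, i) * x $ l)"
    using append_cols_carrier[OF A B] x i by (simp add: scalar_prod_def)
  also have "\<dots> = (\<Sum>l = 0..<k. (if i < r then A $$ (l, i) else B $$ (l, i - r)) * x $ l)"
    using A B i by (intro sum.cong) (auto simp: append_cols_def)
  also have "\<dots> = ((A\<^sup>T *\<^sub>v x) @\<^sub>v (B\<^sup>T *\<^sub>v x)) $ i"
    using A B x i by (auto simp: scalar_prod_def)
  finally show "((A @\<^sub>c B)\<^sup>T *\<^sub>v x) $ i = ((A\<^sup>T *\<^sub>v x) @\<^sub>v (B\<^sup>T *\<^sub>v x)) $ i" .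
qed

text \<open>Presents a codeword as the image of a single map on coefficient vectors, whose two
  halves can be projected out separately.\<close>

lemma tau_inv_append_cols:
  assumes "A \<in> carrier_mat k r" and "B \<in> carrier_mat k s"
  shows "tau_inv (A @\<^sub>c B) = (\<lambda>x. (A\<^sup>T *\<^sub>v x) @\<^sub>v (B\<^sup>T *\<^sub>v (x :: 'a::field vec))) ` carrier_vec k"
  using tau_inv_eq_range[OF append_cols_carrier[OF assms]] append_cols_transpose_mult_vec[OF assms]
  by (auto simp: image_def)

text \<open>If either half determines the coefficients, so does the concatenation; hence the row
  space has q^k elements.\<close>

lemma tau_inv_append_cols_subspace:
  fixes A B :: "'a::{field,finite} mat"
  assumes A: "A \<in> carrier_mat k r" and B: "B \<in> carrier_mat k s"
    and inj: "inj_on (\<lambda>x. A\<^sup>T *\<^sub>v x) (carrier_vec k) \<or> inj_on (\<lambda>x. B\<^sup>T *\<^sub>v x) (carrier_vec k)"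
  shows "subspace class_ring (tau_inv (A @\<^sub>c B)) (module_vec TYPE('a) (r + s))"
    and "subspace_dim (r + s) (tau_inv (A @\<^sub>c B)) = k"
proof -
  note C = append_cols_carrier[OF A B]
  show S: "subspace class_ring (tau_inv (A @\<^sub>c B)) (module_vec TYPE('a) (r + s))"
    unfolding tau_inv_eq_range[OF C] using C by (intro range_mult_mat_vec_subspace) simp
  have "inj_on (\<lambda>x. (A\<^sup>T *\<^sub>v x) @\<^sub>v (B\<^sup>T *\<^sub>v x)) (carrier_vec k)"
    using inj A B by (auto simp: inj_on_def append_vec_eq[of _ r])
  then show "subspace_dim (r + s) (tau_inv (A @\<^sub>c B)) = k"
    unfolding subspace_dim_eq_iff[OF S] unfolding tau_inv_append_cols[OF A B]
    by (simp add: card_image carrier_vec_finite_field(2))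
qed

section \<open>Bounds for intersections of codewords\<close>

text \<open>On \<open>S\<close> the composite of \<open>f\<close> and \<open>g\<close> is the
  injective \<open>h\<close>, so \<open>g\<close> embeds the intersection. In the applications
  \<open>g\<close> projects to the first \<open>r\<close> or to the last \<open>s + t\<close>
  coordinates.\<close>

lemma card_range_Int_le:
  assumes inj: "inj_on h S" and gf: "\<And>x. x \<in> S \<Longrightarrow> g (f x) = h x"
    and gW: "g ` W \<subseteq> T" and fin: "finite S"
  shows "card (f ` S \<inter> W) \<le> card (h ` S \<inter> T)"
proof (rule card_inj_on_le[where f = g])
  show "inj_on g (f ` S \<inter> W)"
  proof (rule inj_onI)
    fix u w assume "u \<in> f ` S \<inter> W" "w \<in> f ` S \<inter> W" and eq: "g u = g w"
    then obtain x y where "x \<in> S" "u = f x" "y \<in> S" "w = f y" by blast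
    then show "u = w" using eq gf inj_onD[OF inj] by metis
  qed
  show "g ` (f ` S \<inter> W) \<subseteq> h ` S \<inter> T"
  proof
    fix z assume "z \<in> g ` (f ` S \<inter> W)"
    then obtain x where x: "x \<in> S" "f x \<in> W" "z = g (f x)" by blast
    then show "z \<in> h ` S \<inter> T" using gf[OF x(1)] gW by auto
  qed
  show "finite (h ` S \<inter> T)" using fin by simp
qed

text \<open>As \<open>1 \<le> e\<close>, the intersection bound also forces distinct indices to give
  distinct spaces: a coincidence would put q^k vectors into an intersection of at most q^(k-e).
  Hence codewords may be counted by their indices.\<close>

lemma is_cdc_image:
  fixes F :: "'i \<Rightarrow> 'a::{field,finite} vec set"
  assumes fin: "finite I" and e: "1 \<le> e" "e \<le> k"
    and sub: "\<And>i. i \<in> I \<Longrightarrow> subspace class_ring (F i) (module_vec TYPE('a) v)"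
    and dim: "\<And>i. i \<in> I \<Longrightarrow> subspace_dim v (F i) = k"
    and Int: "\<And>i j. i \<in> I \<Longrightarrow> j \<in> I \<Longrightarrow> i \<noteq> j \<Longrightarrow> card (F i \<inter> F j) \<le> CARD('a) ^ (k - e)"
  shows "is_cdc v (card I) (2 * e) k (F ` I)"
proof -
  have "inj_on F I"
  proof (rule inj_onI, rule ccontr)
    fix i j assume ij: "i \<in> I" "j \<in> I" "F i = F j" "i \<noteq> j"
    then have "CARD('a) ^ k \<le> CARD('a) ^ (k - e)"
      using Int[of i j] card_subspace[OF sub[OF ij(1)]] dim[OF ij(1)] by simp
    then show False using CARD_field_gt_1[where 'a='a] e by simp
  qed
  then have "card (F ` I) = card I" by (rule card_image)
  moreover have "2 * e \<le> subspace_dist v (F i) (F j)" if "i \<in> I" "j \<in> I" "F i \<noteq> F j" for i j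
    using that subspace_dist_ge_iff[OF sub dim sub dim e(2), of i j] Int[of i j] by auto
  ultimately show ?thesis using fin sub dim unfolding is_cdc_def by auto
qed

text \<open>A common vector comes from a coefficient vector in the kernel of the transpose of
  \<open>M - M'\<close>, whose dimension is \<open>k - rank_dist M M'\<close>. Abstract
  \<open>f\<close> and \<open>f'\<close> let the bound serve both families, with the shared block on
  either side.\<close>

lemma card_same_prefix_Int_le:
  fixes M M' :: "'a::{field,finite} mat"
  assumes M: "M \<in> carrier_mat k s" and M': "M' \<in> carrier_mat k s" and e: "e \<le> rank_dist M M'"
    and f: "\<And>x y. x \<in> carrier_vec k \<Longrightarrow> y \<in> carrier_vec k \<Longrightarrow> f x = f' y \<Longrightarrow> x = y \<and> M\<^sup>T *\<^sub>v x = M'\<^sup>T *\<^sub>v x"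
  shows "card (f ` carrier_vec k \<inter> f' ` carrier_vec k) \<le> CARD('a) ^ (k - e)"
proof -
  let ?D = "(M - M')\<^sup>T"
  let ?K = "{x \<in> carrier_vec k. ?D *\<^sub>v x = 0\<^sub>v s}"
  have finK: "finite ?K"
    using carrier_vec_finite_field(1)[of k] by (rule rev_finite_subset) blast
  have D: "?D \<in> carrier_mat s k" using M M' by (simp add: minus_carrier_mat)
  have "f ` carrier_vec k \<inter> f' ` carrier_vec k \<subseteq> f ` ?K"
  proof
    fix w assume "w \<in> f ` carrier_vec k \<inter> f' ` carrier_vec k"
    then obtain x y where x: "x \<in> carrier_vec k" "w = f x" and y: "y \<in> carrier_vec k" "w = f' y" by auto
    have "M\<^sup>T *\<^sub>v x = M'\<^sup>T *\<^sub>v x" using f[of x y] x y by metis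
    moreover have "?D *\<^sub>v x = M\<^sup>T *\<^sub>v x - M'\<^sup>T *\<^sub>v x"
      using M M' x by (simp add: transpose_minus minus_mult_distrib_mat_vec[of _ s k])
    ultimately have "?D *\<^sub>v x = 0\<^sub>v s" using M' x by simp
    then show "w \<in> f ` ?K" using x by auto
  qed
  then have "card (f ` carrier_vec k \<inter> f' ` carrier_vec k) \<le> card (f ` ?K)"
    using finK by (intro card_mono finite_imageI)
  also have "\<dots> \<le> card ?K" using finK by (rule card_image_le)
  also have "\<dots> = CARD('a) ^ (k - rank_dist M M')"
    unfolding card_kernel_mat[OF D] mat_rank_transpose rank_dist_def ..
  also have "\<dots> \<le> CARD('a) ^ (k - e)"
    using e CARD_field_gt_1[where 'a='a] by (intro power_increasing) auto
  finally show ?thesis .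
qed

text \<open>\<open>R\<close> leaves q^rank(R) choices for the first part, and the remaining
  \<open>t\<close> coordinates leave at most q^t.\<close>

lemma card_append_first_cols_le:
  fixes R :: "'a::{field,finite} mat"
  assumes R: "R \<in> carrier_mat k n" and W: "W \<subseteq> carrier_vec t"
  shows "card ((\<lambda>(x, y). x @\<^sub>v y) ` ((\<lambda>x. R\<^sup>T *\<^sub>v x) ` carrier_vec k \<times> W)) \<le> CARD('a) ^ (mat_rank R + t)"
proof -
  have fin: "finite W" using W carrier_vec_finite_field(1) by (rule finite_subset)
  have "card ((\<lambda>(x, y). x @\<^sub>v y) ` ((\<lambda>x. R\<^sup>T *\<^sub>v x) ` carrier_vec k \<times> W))
      \<le> card ((\<lambda>x. R\<^sup>T *\<^sub>v x) ` carrier_vec k \<times> W)"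
    using fin carrier_vec_finite_field(1) by (intro card_image_le) auto
  also have "\<dots> = CARD('a) ^ mat_rank R * card W"
    using card_range_mult_mat_vec[of "R\<^sup>T" n k] R by (simp add: card_cartesian_product mat_rank_transpose)
  also have "\<dots> \<le> CARD('a) ^ mat_rank R * CARD('a) ^ t"
    using card_mono[OF carrier_vec_finite_field(1) W] by (simp add: carrier_vec_finite_field(2))
  finally show ?thesis by (simp add: power_add)
qed

text \<open>Each pair of codewords is brought under the bound q^(k-e): \<open>11\<close> and
  \<open>22\<close> treat pairs within a family, \<open>12\<close> the mixed pairs.\<close>

theorem generalized_linkage_is_cdc:
  fixes \<A> \<B> :: "'a::{field,finite} vec set set" and \<M> \<R> :: "'a mat set"
  assumes e: "1 \<le> e" "e \<le> k" and t: "t \<le> k - e" and kr: "k \<le> r"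
    and A: "is_cdc r (card \<A>) (2 * e) k \<A>" and B: "is_cdc (s + t) (card \<B>) (2 * e) k \<B>"
    and M: "rank_metric_code k s e \<M>" and R: "rank_metric_code k (r - t) e \<R>"
    and Rrank: "\<And>R. R \<in> \<R> \<Longrightarrow> mat_rank R \<le> k - e - t"
  shows "is_cdc (r + s) (card \<A> * card \<M> + card \<R> * card \<B>) (2 * e) k
    ({tau_inv (tau r A @\<^sub>c M) | A M. A \<in> \<A> \<and> M \<in> \<M>} \<union>
     {tau_inv (R @\<^sub>c tau (s + t) B) | R B. R \<in> \<R> \<and> B \<in> \<B>})"
proof -
  let ?S = "carrier_vec k :: 'a vec set"
  define F1 where "F1 = (\<lambda>(A, M). tau_inv (tau r A @\<^sub>c M) :: 'a vec set)"
  define F2 where "F2 = (\<lambda>(R, B). tau_inv (R @\<^sub>c tau (s + t) B) :: 'a vec set)"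
  have finM: "finite \<M>" and finR: "finite \<R>"
    using M R finite_carrier_mat finite_subset unfolding rank_metric_code_def by blast+
  have finA: "finite \<A>" and finB: "finite \<B>" using A B by (auto simp: is_cdc_def)
  \<comment> \<open>Both families live in the same ambient space, because
    \<open>t \<le> r\<close>.\<close>
  have rs: "(r - t) + (s + t) = r + s" using t kr by simp
  have Ac: "tau r A \<in> carrier_mat k r" "(\<lambda>x. (tau r A)\<^sup>T *\<^sub>v x) ` ?S = A"
      "inj_on (\<lambda>x. (tau r A)\<^sup>T *\<^sub>v x) ?S" if "A \<in> \<A>" for A
    using A that tau_spec[of A r k] by (auto simp: is_cdc_def)
  have Bc: "tau (s + t) B \<in> carrier_mat k (s + t)" "(\<lambda>x. (tau (s + t) B)\<^sup>T *\<^sub>v x) ` ?S = B"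
      "inj_on (\<lambda>x. (tau (s + t) B)\<^sup>T *\<^sub>v x) ?S" if "B \<in> \<B>" for B
    using B that tau_spec[of B "s + t" k] by (auto simp: is_cdc_def)
  have Mc: "M \<in> carrier_mat k s" if "M \<in> \<M>" for M
    using M that by (auto simp: rank_metric_code_def)
  have Rc: "R \<in> carrier_mat k (r - t)" if "R \<in> \<R>" for R
    using R that by (auto simp: rank_metric_code_def)
  have F1: "F1 (A, M) = (\<lambda>x. ((tau r A)\<^sup>T *\<^sub>v x) @\<^sub>v (M\<^sup>T *\<^sub>v x)) ` ?S" if "A \<in> \<A>" "M \<in> \<M>" for A M
    unfolding F1_def using tau_inv_append_cols[OF Ac(1) Mc] that by simp
  have F2: "F2 (R, B) = (\<lambda>x. (R\<^sup>T *\<^sub>v x) @\<^sub>v ((tau (s + t) B)\<^sup>T *\<^sub>v x)) ` ?S" if "R \<in> \<R>" "B \<in> \<B>" for R B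
    unfolding F2_def using tau_inv_append_cols[OF Rc Bc(1)] that by simp
  have sub1: "subspace class_ring (F1 (A, M)) (module_vec TYPE('a) (r + s))"
      "subspace_dim (r + s) (F1 (A, M)) = k" if "A \<in> \<A>" "M \<in> \<M>" for A M
    unfolding F1_def using tau_inv_append_cols_subspace[OF Ac(1) Mc] Ac(3) that by auto
  have sub2: "subspace class_ring (F2 (R, B)) (module_vec TYPE('a) (r + s))"
      "subspace_dim (r + s) (F2 (R, B)) = k" if "R \<in> \<R>" "B \<in> \<B>" for R B
    unfolding F2_def using tau_inv_append_cols_subspace[OF Rc Bc(1)] Bc(3) that by (auto simp: rs)
  have codeInt: "card (U \<inter> W) \<le> CARD('a) ^ (k - e)"
    if "is_cdc v (card C) (2 * e) k C" "U \<in> C" "W \<in> C" "U \<noteq> W" for v and C :: "'a vec set set" and U W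
    using that e by (subst subspace_dist_ge_iff[of U v k W e, symmetric]) (auto simp: is_cdc_def)
  have 11: "card (F1 (A, M) \<inter> F1 (A', M')) \<le> CARD('a) ^ (k - e)"
    if mem: "A \<in> \<A>" "M \<in> \<M>" "A' \<in> \<A>" "M' \<in> \<M>" and ne: "(A, M) \<noteq> (A', M')" for A M A' M'
  proof (cases "A = A'")
    case True
    then have "e \<le> rank_dist M M'" using mem ne assms(7) by (auto simp: rank_metric_code_def)
    then show ?thesis
      unfolding F1[OF mem(1,2)] F1[OF mem(3,4)] unfolding True
    proof (rule card_same_prefix_Int_le[OF Mc[OF mem(2)] Mc[OF mem(4)]])
      fix x y assume xy: "x \<in> ?S" "y \<in> ?S"
        "(tau r A')\<^sup>T *\<^sub>v x @\<^sub>v M\<^sup>T *\<^sub>v x = (tau r A')\<^sup>T *\<^sub>v y @\<^sub>v M'\<^sup>T *\<^sub>v y"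
      then have "(tau r A')\<^sup>T *\<^sub>v x = (tau r A')\<^sup>T *\<^sub>v y" "M\<^sup>T *\<^sub>v x = M'\<^sup>T *\<^sub>v y"
        using Ac(1)[OF mem(3)] by (simp_all add: append_vec_eq[of _ r])
      then show "x = y \<and> M\<^sup>T *\<^sub>v x = M'\<^sup>T *\<^sub>v x"
        using inj_onD[OF Ac(3)[OF mem(3)] _ xy(1,2)] by metis
    qed
  next
    case False
    \<comment> \<open>Projection to the first \<open>r\<close> coordinates maps the first codeword
      injectively onto \<open>A\<close> and the second into \<open>A'\<close>.\<close>
    have "card (F1 (A, M) \<inter> F1 (A', M')) \<le> card ((\<lambda>x. (tau r A)\<^sup>T *\<^sub>v x) ` ?S \<inter> A')"
      unfolding F1[OF mem(1,2)]
    proof (rule card_range_Int_le[where g = "\<lambda>w. vec_first w r"])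
      show "(\<lambda>w. vec_first w r) ` F1 (A', M') \<subseteq> A'"
        unfolding F1[OF mem(3,4)] using Ac(1,2)[OF mem(3)] by (auto simp: vec_first_append)
    qed (use Ac(1,3)[OF mem(1)] carrier_vec_finite_field(1) in \<open>auto simp: vec_first_append\<close>)
    then show ?thesis using codeInt[OF A mem(1) mem(3) False] Ac(2)[OF mem(1)] by simp
  qed
  have 22: "card (F2 (R, B) \<inter> F2 (R', B')) \<le> CARD('a) ^ (k - e)"
    if mem: "R \<in> \<R>" "B \<in> \<B>" "R' \<in> \<R>" "B' \<in> \<B>" and ne: "(R, B) \<noteq> (R', B')" for R B R' B'
  proof (cases "B = B'")
    case True
    then have "e \<le> rank_dist R R'" using mem ne assms(8) by (auto simp: rank_metric_code_def)
    then show ?thesis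
      unfolding F2[OF mem(1,2)] F2[OF mem(3,4)] unfolding True
    proof (rule card_same_prefix_Int_le[OF Rc[OF mem(1)] Rc[OF mem(3)]])
      fix x y assume xy: "x \<in> ?S" "y \<in> ?S"
        "R\<^sup>T *\<^sub>v x @\<^sub>v (tau (s + t) B')\<^sup>T *\<^sub>v x = R'\<^sup>T *\<^sub>v y @\<^sub>v (tau (s + t) B')\<^sup>T *\<^sub>v y"
      then have "(tau (s + t) B')\<^sup>T *\<^sub>v x = (tau (s + t) B')\<^sup>T *\<^sub>v y" "R\<^sup>T *\<^sub>v x = R'\<^sup>T *\<^sub>v y"
        using Rc[OF mem(1)] Rc[OF mem(3)] by (simp_all add: append_vec_eq[of _ "r - t"])
      then show "x = y \<and> R\<^sup>T *\<^sub>v x = R'\<^sup>T *\<^sub>v x"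
        using inj_onD[OF Bc(3)[OF mem(4)] _ xy(1,2)] by metis
    qed
  next
    case False
    have "card (F2 (R, B) \<inter> F2 (R', B')) \<le> card ((\<lambda>x. (tau (s + t) B)\<^sup>T *\<^sub>v x) ` ?S \<inter> B')"
      unfolding F2[OF mem(1,2)]
    proof (rule card_range_Int_le[where g = "\<lambda>w. vec_last w (s + t)"])
      show "(\<lambda>w. vec_last w (s + t)) ` F2 (R', B') \<subseteq> B'"
        unfolding F2[OF mem(3,4)] using Bc(1,2)[OF mem(4)] by (auto simp: vec_last_append)
    qed (use Bc(1,3)[OF mem(2)] carrier_vec_finite_field(1) in \<open>auto simp: vec_last_append\<close>)
    then show ?thesis using codeInt[OF B mem(2) mem(4) False] Bc(2)[OF mem(2)] by simp
  qed
  have 12: "card (F1 (A, M) \<inter> F2 (R, B)) \<le> CARD('a) ^ (k - e)"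
    if mem: "A \<in> \<A>" "M \<in> \<M>" "R \<in> \<R>" "B \<in> \<B>" for A M R B
  proof -
    let ?T = "(\<lambda>(x, y). x @\<^sub>v y) ` ((\<lambda>x. R\<^sup>T *\<^sub>v x) ` ?S \<times> (carrier_vec t :: 'a vec set))"
    have "card (F1 (A, M) \<inter> F2 (R, B)) \<le> card ((\<lambda>x. (tau r A)\<^sup>T *\<^sub>v x) ` ?S \<inter> ?T)"
      unfolding F1[OF mem(1,2)]
    proof (rule card_range_Int_le[where g = "\<lambda>w. vec_first w r"])
      show "(\<lambda>w. vec_first w r) ` F2 (R, B) \<subseteq> ?T"
      proof
        fix w assume "w \<in> (\<lambda>w. vec_first w r) ` F2 (R, B)"
        then obtain x where x: "x \<in> ?S"
          and w: "w = vec_first ((R\<^sup>T *\<^sub>v x) @\<^sub>v ((tau (s + t) B)\<^sup>T *\<^sub>v x)) r"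
          unfolding F2[OF mem(3,4)] by auto
        \<comment> \<open>The first \<open>r\<close> coordinates are the \<open>r - t\<close>
          coordinates from \<open>R\<close> followed by the first \<open>t\<close> from
          \<open>tau (s + t) B\<close>.\<close>
        have "w = (R\<^sup>T *\<^sub>v x) @\<^sub>v vec_first ((tau (s + t) B)\<^sup>T *\<^sub>v x) t"
          unfolding w vec_first_def using Rc[OF mem(3)] Bc(1)[OF mem(4)] x t kr
          by (intro eq_vecI) (auto simp: vec_first_def)
        then show "w \<in> ?T"
          by (intro image_eqI[where x = "(R\<^sup>T *\<^sub>v x, vec_first ((tau (s + t) B)\<^sup>T *\<^sub>v x) t)"])
            (use x in auto)
      qed
    qed (use Ac(1,3)[OF mem(1)] carrier_vec_finite_field(1) in \<open>auto simp: vec_first_append\<close>)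
    also have "\<dots> \<le> card ?T" using carrier_vec_finite_field(1) by (intro card_mono) auto
    also have "\<dots> \<le> CARD('a) ^ (mat_rank R + t)"
      by (rule card_append_first_cols_le[OF Rc[OF mem(3)] order_refl])
    \<comment> \<open>The rank bound on \<open>R\<close> is made for this step: (k - e - t) + t = k
      - e.\<close>
    also have "\<dots> \<le> CARD('a) ^ (k - e)"
      using Rrank[OF mem(3)] t CARD_field_gt_1[where 'a='a] by (intro power_increasing) auto
    finally show ?thesis .
  qed
  \<comment> \<open>A disjoint sum of index sets makes the number of indices the desired sum and
    turns mixed pairs into pairs of distinct indices.\<close>
  define I where "I = (\<A> \<times> \<M>) <+> (\<R> \<times> \<B>)"
  have "is_cdc (r + s) (card I) (2 * e) k (case_sum F1 F2 ` I)"
  proof (rule is_cdc_image)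
    show "finite I" unfolding I_def using finA finB finM finR by simp
    show "card (case_sum F1 F2 i \<inter> case_sum F1 F2 j) \<le> CARD('a) ^ (k - e)"
      if "i \<in> I" "j \<in> I" "i \<noteq> j" for i j
    proof (cases i; cases j)
      fix x y assume ij: "i = Inl x" "j = Inl y"
      then show ?thesis using that 11[of "fst x" "snd x" "fst y" "snd y"] by (auto simp: I_def)
    next
      fix x y assume ij: "i = Inr x" "j = Inr y"
      then show ?thesis using that 22[of "fst x" "snd x" "fst y" "snd y"] by (auto simp: I_def)
    next
      fix x y assume ij: "i = Inl x" "j = Inr y"
      then show ?thesis using that 12[of "fst x" "snd x" "fst y" "snd y"] by (auto simp: I_def)
    next
      fix x y assume ij: "i = Inr x" "j = Inl y"
      then show ?thesis using that 12[of "fst y" "snd y" "fst x" "snd x"]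
        by (auto simp: I_def Int_commute)
    qed
  qed (use e sub1 sub2 in \<open>auto simp: I_def\<close>)
  moreover have "card I = card \<A> * card \<M> + card \<R> * card \<B>"
    unfolding I_def using finA finB finM finR by (simp add: card_Plus card_cartesian_product)
  moreover have "case_sum F1 F2 ` I = {tau_inv (tau r A @\<^sub>c M) | A M. A \<in> \<A> \<and> M \<in> \<M>} \<union>
     {tau_inv (R @\<^sub>c tau (s + t) B) | R B. R \<in> \<R> \<and> B \<in> \<B>}"
    unfolding I_def F1_def F2_def Plus_def image_Un image_image
    by (intro arg_cong2[where f = "(\<union>)"]) force+
  ultimately show ?thesis by simp
qed

section \<open>Maximum rank distance codes\<close>

text \<open>Multiplication by \<open>x \<noteq> 0\<close> permutes the nonzero elements; comparing
  their products gives x^(q-1) = 1.\<close>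

lemma finite_field_power_card: "(x :: 'a::{field,finite}) ^ CARD('a) = x"
proof (cases "x = 0")
  case False
  let ?S = "UNIV - {0 :: 'a}"
  have "bij_betw (\<lambda>y. x * y) ?S ?S"
    by (rule bij_betwI[where g = "\<lambda>y. y / x"]) (use False in auto)
  then have "(\<Prod>y\<in>?S. x * y) = \<Prod>?S" by (rule prod.reindex_bij_betw)
  then have "x ^ card ?S * \<Prod>?S = 1 * \<Prod>?S" by (simp add: prod.distrib)
  moreover have "\<Prod>?S \<noteq> 0" by simp
  ultimately have "x ^ card ?S = 1" by (metis mult_right_cancel)
  then have "x ^ Suc (card ?S) = x" by (simp only: power_Suc mult_1_right)
  moreover have "CARD('a) = Suc (card ?S)" using card_Suc_Diff1[of UNIV "0 :: 'a"] by simp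
  ultimately show ?thesis by (simp only:)
qed (simp add: power_0_left)

text \<open>The polynomial \<open>(X + 1)\<^sup>q - X\<^sup>q - 1\<close> vanishes on the whole field, but its degree is less
  than \<open>q\<close>.\<close>

lemma of_nat_CARD_choose_eq_0:
  assumes "0 < i" "i < CARD('a::{field,finite})"
  shows "of_nat (CARD('a) choose i) = (0 :: 'a)"
proof -
  let ?q = "CARD('a)"
  define P :: "'a poly" where "P = (\<Sum>i = 1..<?q. Polynomial.monom (of_nat (?q choose i)) i)"
  have root: "poly P x = 0" for x
  proof -
    have "{..?q} = insert 0 (insert ?q {1..<?q})" using CARD_field_gt_1[where 'a='a] by auto
    then have "(x + 1) ^ ?q = 1 + (x ^ ?q + poly P x)"
      using CARD_field_gt_1[where 'a='a]
      by (simp add: binomial_ring[of x 1] P_def poly_sum poly_monom)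
    then show ?thesis by (simp add: finite_field_power_card)
  qed
  have "P = 0"
  proof (rule ccontr)
    assume "P \<noteq> 0"
    then have "card {x. poly P x = 0} \<le> Polynomial.degree P" by (rule card_poly_roots_bound)
    also have "Polynomial.degree P \<le> ?q - 1"
      unfolding P_def by (intro degree_sum_le) (auto intro: order_trans[OF degree_monom_le])
    finally show False using root CARD_field_gt_1[where 'a='a] by simp
  qed
  moreover have "Polynomial.coeff P i = of_nat (?q choose i)"
    using assms by (simp add: P_def coeff_sum sum.delta)
  ultimately show ?thesis by simp
qed

text \<open>The inner binomial coefficients vanish in the ground field, hence in its closure. The
  exponent is q rather than the characteristic, as linearity over the ground field requires.\<close>

lemma alg_closure_power_CARD_add:
  "((x :: 'a::{field,finite} alg_closure) + y) ^ CARD('a) = x ^ CARD('a) + y ^ CARD('a)"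
proof -
  let ?q = "CARD('a)"
  have "{..?q} = insert 0 (insert ?q {1..<?q})" using CARD_field_gt_1[where 'a='a] by auto
  moreover have "(\<Sum>i = 1..<?q. of_nat (?q choose i) * x ^ i * y ^ (?q - i)) = 0"
  proof (rule sum.neutral, rule ballI)
    fix i assume "i \<in> {1..<?q}"
    then have "of_nat (?q choose i) = (0 :: 'a)" by (intro of_nat_CARD_choose_eq_0) auto
    then have "of_nat (?q choose i) = (0 :: 'a alg_closure)" by (metis to_ac_of_nat to_ac_0)
    then show "of_nat (?q choose i) * x ^ i * y ^ (?q - i) = 0" by simp
  qed
  ultimately show ?thesis using CARD_field_gt_1[where 'a='a] by (simp add: binomial_ring[of x y])
qed

lemma alg_closure_power_CARD_power_add:
  "((x :: 'a::{field,finite} alg_closure) + y) ^ (CARD('a) ^ i) = x ^ (CARD('a) ^ i) + y ^ (CARD('a) ^ i)"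
proof (induction i)
  case (Suc i)
  then show ?case by (simp only: power_Suc2 power_mult alg_closure_power_CARD_add)
qed simp

lemma alg_closure_power_CARD_power_sum:
  "(\<Sum>j\<in>A. f j :: 'a::{field,finite} alg_closure) ^ (CARD('a) ^ i) = (\<Sum>j\<in>A. f j ^ (CARD('a) ^ i))"
  by (induction A rule: infinite_finite_induct)
    (simp_all add: alg_closure_power_CARD_power_add power_0_left)

text \<open>Together with additivity this makes the q^i-th power maps linear over the ground
  field.\<close>

lemma to_ac_power_CARD_power: "to_ac (c :: 'a::{field,finite}) ^ (CARD('a) ^ i) = to_ac c"
proof -
  have "c ^ (CARD('a) ^ i) = c"
    by (induction i) (simp_all add: power_mult finite_field_power_card)
  then show ?thesis by (metis to_ac_power)
qed

section \<open>The field with q^n elements\<close>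

text \<open>The fixed points of an iterated Frobenius map, for positive \<open>n\<close> the field
  with q^n elements. It is a set rather than a type because \<open>n\<close> varies.\<close>

definition ac_subfield :: "nat \<Rightarrow> 'a::{field,finite} alg_closure set" where
  "ac_subfield n = {x. x ^ (CARD('a) ^ n) = x}"

lemma ac_subfield_closed:
  fixes x y :: "'a::{field,finite} alg_closure"
  shows
  "x \<in> ac_subfield n \<Longrightarrow> y \<in> ac_subfield n \<Longrightarrow> x + y \<in> ac_subfield n"
  "x \<in> ac_subfield n \<Longrightarrow> y \<in> ac_subfield n \<Longrightarrow> x * y \<in> ac_subfield n"
  "0 \<in> ac_subfield n" "to_ac c \<in> ac_subfield n"
  "x \<in> ac_subfield n \<Longrightarrow> x ^ i \<in> ac_subfield n"
proof -
  show "x \<in> ac_subfield n \<Longrightarrow> y \<in> ac_subfield n \<Longrightarrow> x + y \<in> ac_subfield n"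
    by (simp add: ac_subfield_def alg_closure_power_CARD_power_add)
  show "x \<in> ac_subfield n \<Longrightarrow> y \<in> ac_subfield n \<Longrightarrow> x * y \<in> ac_subfield n"
    by (simp add: ac_subfield_def power_mult_distrib)
  show "0 \<in> ac_subfield n" by (simp add: ac_subfield_def)
  show "to_ac c \<in> ac_subfield n" by (simp only: ac_subfield_def to_ac_power_CARD_power mem_Collect_eq)
  assume "x \<in> ac_subfield n"
  moreover have "(x ^ i) ^ (CARD('a) ^ n) = (x ^ (CARD('a) ^ n)) ^ i"
    by (simp only: power_mult[symmetric] mult.commute)
  ultimately show "x ^ i \<in> ac_subfield n" by (simp only: ac_subfield_def mem_Collect_eq)
qed

lemma ac_subfield_sum: "(\<And>j. j \<in> A \<Longrightarrow> f j \<in> ac_subfield n) \<Longrightarrow> (\<Sum>j\<in>A. f j) \<in> ac_subfield n"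
  by (induction A rule: infinite_finite_induct) (auto intro: ac_subfield_closed)

text \<open>The elements are the roots of X^(q^n) - X, which splits over the closure; its derivative
  is the constant -1, so all roots are simple. For n = 0 the polynomial would be zero.\<close>

lemma card_ac_subfield:
  assumes "0 < n"
  shows "finite (ac_subfield n :: 'a::{field,finite} alg_closure set)"
    and "card (ac_subfield n :: 'a alg_closure set) = CARD('a) ^ n"
proof -
  let ?Q = "CARD('a) ^ n"
  have Q: "?Q > 1" by (rule one_less_power[OF CARD_field_gt_1 assms])
  define P :: "'a alg_closure poly" where "P = Polynomial.monom 1 ?Q - Polynomial.monom 1 1"
  have cP: "Polynomial.coeff P ?Q = 1" using Q by (simp add: P_def)
  have deg: "Polynomial.degree P = ?Q"
  proof (rule antisym)
    show "Polynomial.degree P \<le> ?Q"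
      unfolding P_def using Q by (intro degree_diff_le) (auto simp: degree_monom_eq)
    show "?Q \<le> Polynomial.degree P" using cP by (intro le_degree) simp
  qed
  have roots: "ac_subfield n = {x. poly P x = 0}" by (simp add: ac_subfield_def P_def poly_monom)
  have P0: "P \<noteq> 0" using cP by auto
  show "finite (ac_subfield n :: 'a alg_closure set)"
    unfolding roots using P0 by (rule poly_roots_finite)
  obtain A where A: "size A = Polynomial.degree P" "P = smult (Polynomial.lead_coeff P) (\<Prod>x\<in>#A. [:-x, 1:])"
    using alg_closed_imp_factorization[OF P0] by blast
  have PA: "P = (\<Prod>x\<in>#A. [:-x, 1:])" using A(2) deg cP by simp
  \<comment> \<open>The case \<open>i = 1\<close> of the statement on binomial coefficients: q
    itself is zero in the field.\<close>
  have "of_nat (CARD('a)) = (0 :: 'a)"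
    using of_nat_CARD_choose_eq_0[of 1, where 'a='a] CARD_field_gt_1[where 'a='a] by simp
  then have "of_nat (CARD('a)) = (0 :: 'a alg_closure)" by (metis to_ac_of_nat to_ac_0)
  then have der: "pderiv P = - 1"
    using assms by (simp add: P_def pderiv_diff pderiv_monom power_0_left)
  have "count A x \<le> 1" for x
  proof (rule ccontr)
    assume "\<not> count A x \<le> 1"
    then have "{#x, x#} \<subseteq># A" by (simp add: subseteq_mset_def)
    then obtain B where "A = {#x, x#} + B" by (metis subset_mset.le_iff_add)
    \<comment> \<open>As a repeated root, \<open>x\<close> would also be a root of the
      derivative.\<close>
    then have "P = [:-x, 1:] * ([:-x, 1:] * (\<Prod>x\<in>#B. [:-x, 1:]))" unfolding PA by simp
    then have "poly (pderiv P) x = 0"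
      by (simp only: pderiv_mult poly_add poly_mult) simp
    then show False by (simp add: der)
  qed
  then have "count A x = count (mset_set (set_mset A)) x" for x
    using count_greater_eq_one_iff[of A x] by (cases "x \<in># A") (simp_all add: le_antisym not_in_iff)
  then have "A = mset_set (set_mset A)" by (rule multiset_eqI)
  then have "card (set_mset A) = size A" by (metis size_mset_set)
  moreover have "set_mset A = {x. poly P x = 0}"
    unfolding PA by (auto simp: poly_prod_mset prod_mset_zero_iff)
  ultimately show "card (ac_subfield n :: 'a alg_closure set) = ?Q"
    using roots A(1) deg by simp
qed

definition ac_comb :: "(nat \<Rightarrow> 'a::{field,finite} alg_closure) \<Rightarrow> nat \<Rightarrow> 'a vec \<Rightarrow> 'a alg_closure" where
  "ac_comb b n v = (\<Sum>j<n. to_ac (v $ j) * b j)"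

text \<open>A maximal independent subset gives coordinates; that it has exactly \<open>n\<close>
  elements follows by counting, from q^m = q^n.\<close>

lemma ac_subfield_basis:
  assumes n: "0 < n"
  shows "\<exists>b. bij_betw (ac_comb b n) (carrier_vec n) (ac_subfield n :: 'a::{field,finite} alg_closure set)"
proof -
  \<comment> \<open>The closure is a vector space over \<open>'a\<close>, with scalars acting
    through \<open>to_ac\<close>.\<close>
  interpret vector_space "\<lambda>(c :: 'a) x. to_ac c * x"
    by unfold_locales (simp_all add: algebra_simps)
  let ?L = "ac_subfield n :: 'a alg_closure set"
  obtain B where B: "B \<subseteq> ?L" "independent B" "?L \<subseteq> span B"
    using maximal_independent_subset[of ?L] by blast
  have fin: "finite B" using B(1) card_ac_subfield(1)[OF n] by (rule finite_subset)
  define m where "m = card B"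
  obtain b where b: "bij_betw b {..<m} B"
    using ex_bij_betw_nat_finite[OF fin] by (auto simp: m_def atLeast0LessThan)
  \<comment> \<open>A sum over positions becomes a sum over basis elements, where independence
    applies.\<close>
  have comb: "ac_comb b m v = (\<Sum>x\<in>B. to_ac (v $ inv_into {..<m} b x) * x)" for v
    unfolding ac_comb_def using sum.reindex_bij_betw[OF b, of "\<lambda>x. to_ac (v $ inv_into {..<m} b x) * x"]
      bij_betw_imp_inj_on[OF b]
    by (metis (no_types, lifting) inv_into_f_f sum.cong)
  have bij: "bij_betw (ac_comb b m) (carrier_vec m) ?L"
  proof (rule bij_betw_imageI)
    show "inj_on (ac_comb b m) (carrier_vec m)"
    proof (rule inj_onI)
      fix v w :: "'a vec" assume vw: "v \<in> carrier_vec m" "w \<in> carrier_vec m" "ac_comb b m v = ac_comb b m w"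
      let ?u = "\<lambda>x. v $ inv_into {..<m} b x - w $ inv_into {..<m} b x"
      have "(\<Sum>x\<in>B. to_ac (?u x) * x) = 0"
        using vw(3) unfolding comb by (simp add: left_diff_distrib sum_subtractf)
      then have zero: "?u x = 0" if "x \<in> B" for x
        using independentD[OF B(2) fin order_refl, of ?u x] that by simp
      show "v = w"
      proof (rule eq_vecI)
        fix j assume "j < dim_vec w"
        then have "j < m" using vw by simp
        then show "v $ j = w $ j"
          using zero[of "b j"] b by (auto simp: bij_betw_def)
      qed (use vw in simp)
    qed
    show "ac_comb b m ` carrier_vec m = ?L"
    proof (intro equalityI subsetI)
      fix y assume "y \<in> ac_comb b m ` carrier_vec m"
      then show "y \<in> ?L" unfolding comb using B(1)
        by (auto intro!: ac_subfield_sum ac_subfield_closed)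
    next
      fix y assume "y \<in> ?L"
      then have "y \<in> span B" using B by auto
      then obtain u where "y = (\<Sum>x\<in>B. to_ac (u x) * x)"
        unfolding span_finite[OF fin] by auto
      also have "\<dots> = (\<Sum>j<m. to_ac (u (b j)) * b j)"
        using sum.reindex_bij_betw[OF b, of "\<lambda>x. to_ac (u x) * x"] by simp
      also have "\<dots> = ac_comb b m (vec m (\<lambda>j. u (b j)))"
        unfolding ac_comb_def by (intro sum.cong) auto
      finally show "y \<in> ac_comb b m ` carrier_vec m" by auto
    qed
  qed
  have "CARD('a) ^ m = CARD('a) ^ n"
    using bij_betw_same_card[OF bij] by (simp add: carrier_vec_finite_field(2) card_ac_subfield(2)[OF n])
  then have "m = n" using CARD_field_gt_1[where 'a='a] by simp
  then show ?thesis using bij by blast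
qed

section \<open>Linearized polynomials and Delsarte-Gabidulin codes\<close>

definition lin_poly :: "nat \<Rightarrow> (nat \<Rightarrow> 'a::{field,finite} alg_closure) \<Rightarrow> 'a alg_closure \<Rightarrow> 'a alg_closure" where
  "lin_poly K a x = (\<Sum>i<K. a i * x ^ (CARD('a) ^ i))"

text \<open>The q^i-th powers are additive and fix scalars from the ground field.\<close>

lemma lin_poly_comb: "lin_poly K a (ac_comb b m v) = (\<Sum>j<m. to_ac (v $ j) * lin_poly K a (b j))"
proof -
  have "lin_poly K a (ac_comb b m v) = (\<Sum>i<K. \<Sum>j<m. to_ac (v $ j) * (a i * b j ^ (CARD('a) ^ i)))"
    unfolding lin_poly_def ac_comb_def
    by (simp add: alg_closure_power_CARD_power_sum power_mult_distrib to_ac_power_CARD_power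
        sum_distrib_left mult.left_commute)
  also have "\<dots> = (\<Sum>j<m. \<Sum>i<K. to_ac (v $ j) * (a i * b j ^ (CARD('a) ^ i)))"
    by (rule sum.swap)
  finally show ?thesis by (simp add: lin_poly_def sum_distrib_left)
qed

text \<open>As an ordinary polynomial it has degree at most q^(K-1), and it is nonzero because its
  coefficients sit at distinct exponents q^i.\<close>

lemma card_lin_poly_roots:
  fixes a :: "nat \<Rightarrow> 'a::{field,finite} alg_closure"
  assumes i: "i < K" "a i \<noteq> 0"
  shows "finite {x. lin_poly K a x = 0}" "card {x. lin_poly K a x = 0} \<le> CARD('a) ^ (K - 1)"
proof -
  let ?q = "CARD('a)"
  define P where "P = (\<Sum>i<K. Polynomial.monom (a i) (?q ^ i))"
  have "Polynomial.coeff P (?q ^ i) = (\<Sum>l<K. if l = i then a l else 0)"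
    unfolding P_def using CARD_field_gt_1[where 'a='a] by (simp add: coeff_sum)
  then have "Polynomial.coeff P (?q ^ i) = a i" using i by simp
  then have P: "P \<noteq> 0" using i by auto
  have eq: "{x. lin_poly K a x = 0} = {x. poly P x = 0}"
    by (simp add: lin_poly_def P_def poly_sum poly_monom)
  show "finite {x. lin_poly K a x = 0}" unfolding eq using P by (rule poly_roots_finite)
  have "Polynomial.degree P \<le> ?q ^ (K - 1)"
    unfolding P_def using CARD_field_gt_1[where 'a='a]
    by (intro degree_sum_le) (auto intro!: order_trans[OF degree_monom_le] power_increasing)
  then show "card {x. lin_poly K a x = 0} \<le> ?q ^ (K - 1)"
    unfolding eq using card_poly_roots_bound[OF P] by simp
qed

lemma rank_dist_self:
  assumes A: "(A :: 'a::{field,finite} mat) \<in> carrier_mat m n"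
  shows "rank_dist A A = 0"
proof -
  have "A - A = 0\<^sub>m m n" using A by (intro eq_matI) auto
  then have "(\<lambda>x. (A - A) *\<^sub>v x) ` carrier_vec n = {0\<^sub>v m :: 'a vec}"
    by (auto intro!: image_eqI[where x = "0\<^sub>v n"])
  moreover have "A - A \<in> carrier_mat m n" using A by (simp add: minus_carrier_mat)
  ultimately have "CARD('a) ^ mat_rank (A - A) = 1"
    using card_range_mult_mat_vec[of "A - A" m n] by simp
  then show ?thesis using CARD_field_gt_1[where 'a='a] by (simp add: rank_dist_def)
qed

text \<open>Delsarte--Gabidulin codes: the linearized polynomials \<open>\<Sum>\<^sub>i a\<^sub>i X\<^bsup>q^i\<^esup>\<close> of \<open>q\<close>-degree less
  than \<open>m - d + 1\<close>, evaluated at \<open>m\<close> independent elements of the field with \<open>q\<^sup>n\<close> elements.\<close>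

lemma gabidulin_code:
  assumes d: "1 \<le> d" "d \<le> m" and mn: "m \<le> n"
  shows "\<exists>C :: 'a::{field,finite} mat set. rank_metric_code n m d C \<and> card C = CARD('a) ^ (n * (m - d + 1))"
proof -
  let ?q = "CARD('a)"
  \<comment> \<open>\<open>K - 1 = m - d\<close> will bound the kernel dimension of a difference of
    codewords, which forces rank at least \<open>d\<close>.\<close>
  define K where "K = m - d + 1"
  have n: "0 < n" using d mn by simp
  let ?L = "ac_subfield n :: 'a alg_closure set"
  obtain b where b: "bij_betw (ac_comb b n) (carrier_vec n) ?L"
    using ac_subfield_basis[OF n] by blast
  have bL: "b j \<in> ?L" if "j < n" for j
  proof -
    have "ac_comb b n (unit_vec n j) = (\<Sum>i<n. if i = j then b i else 0)"
      unfolding ac_comb_def using that by (intro sum.cong) auto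
    then have "ac_comb b n (unit_vec n j) = b j" using that by simp
    then show ?thesis using b by (metis bij_betwE unit_vec_carrier)
  qed
  \<comment> \<open>Coefficient families; extensionality ensures that distinct ones differ at an
    index below \<open>K\<close>.\<close>
  define E where "E = ({..<K} \<rightarrow>\<^sub>E ?L)"
  have f: "lin_poly K a x \<in> ?L" if "a \<in> E" "x \<in> ?L" for a x
    unfolding lin_poly_def using that
    by (auto simp: E_def PiE_iff intro!: ac_subfield_sum ac_subfield_closed)
  define \<psi> where "\<psi> = inv_into (carrier_vec n) (ac_comb b n)"
  have \<psi>: "\<psi> y \<in> carrier_vec n" "ac_comb b n (\<psi> y) = y" if "y \<in> ?L" for y
    using that b unfolding \<psi>_def by (auto simp: bij_betw_def inv_into_into f_inv_into_f)
  \<comment> \<open>Column \<open>j\<close> holds the coordinates of the value at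
    \<open>b j\<close>, so \<open>G a\<close> is the matrix of the polynomial map on the span of the
    first \<open>m\<close> basis elements.\<close>
  define G where "G a = mat n m (\<lambda>(l, j). \<psi> (lin_poly K a (b j)) $ l)" for a
  have G: "G a \<in> carrier_mat n m" for a by (simp add: G_def)
  have Gv: "ac_comb b n (G a *\<^sub>v v) = lin_poly K a (ac_comb b m v)"
    if a: "a \<in> E" and v: "v \<in> carrier_vec m" for a v
  proof -
    have "ac_comb b n (G a *\<^sub>v v) = (\<Sum>l<n. \<Sum>j<m. to_ac (v $ j) * (to_ac (\<psi> (lin_poly K a (b j)) $ l) * b l))"
      unfolding ac_comb_def using v
      by (simp add: G_def scalar_prod_def to_ac_sum sum_distrib_right sum_distrib_left
          atLeast0LessThan mult_ac)
    also have "\<dots> = (\<Sum>j<m. to_ac (v $ j) * ac_comb b n (\<psi> (lin_poly K a (b j))))"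
      unfolding ac_comb_def sum_distrib_left by (rule sum.swap)
    also have "\<dots> = (\<Sum>j<m. to_ac (v $ j) * lin_poly K a (b j))"
      using \<psi>(2) f[OF a] bL mn by (intro sum.cong) auto
    finally show ?thesis by (simp add: lin_poly_comb)
  qed
  have inj: "inj_on (ac_comb b m) (carrier_vec m)"
  proof (rule inj_onI)
    fix v w :: "'a vec" assume vw: "v \<in> carrier_vec m" "w \<in> carrier_vec m" "ac_comb b m v = ac_comb b m w"
    \<comment> \<open>Padding with zeros reduces injectivity for the first \<open>m\<close> basis
      elements to that for the full basis.\<close>
    have "ac_comb b m u = ac_comb b n (u @\<^sub>v 0\<^sub>v (n - m))" if "u \<in> carrier_vec m" for u :: "'a vec"
      unfolding ac_comb_def using that mn by (intro sum.mono_neutral_cong_left) auto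
    moreover have "u @\<^sub>v 0\<^sub>v (n - m) \<in> carrier_vec n" if "u \<in> carrier_vec m" for u :: "'a vec"
      using append_carrier_vec[OF that zero_carrier_vec[of "n - m"]] mn by simp
    ultimately have "v @\<^sub>v 0\<^sub>v (n - m) = w @\<^sub>v 0\<^sub>v (n - m)"
      using vw b mn by (intro inj_onD[OF bij_betw_imp_inj_on[OF b]]) auto
    then show "v = w" using vw by (simp add: append_vec_eq[of _ m])
  qed
  have dist: "d \<le> rank_dist (G a) (G c)" if ac: "a \<in> E" "c \<in> E" "a \<noteq> c" for a c
  proof -
    obtain i where i: "i < K" "a i - c i \<noteq> 0"
      using ac by (metis E_def PiE_ext lessThan_iff right_minus_eq)
    let ?D = "G a - G c"
    let ?Z = "{x. lin_poly K (\<lambda>i. a i - c i) x = 0}"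
    have D: "?D \<in> carrier_mat n m" using G by (simp add: minus_carrier_mat)
    \<comment> \<open>A kernel vector of the difference yields a root of the polynomial with
      coefficients \<open>a i - c i\<close>, and different vectors yield different roots.\<close>
    have "card {v \<in> carrier_vec m. ?D *\<^sub>v v = 0\<^sub>v n} \<le> card ?Z"
    proof (rule card_inj_on_le[where f = "ac_comb b m"])
      show "inj_on (ac_comb b m) {v \<in> carrier_vec m. ?D *\<^sub>v v = 0\<^sub>v n}"
        using inj by (rule inj_on_subset) auto
      show "ac_comb b m ` {v \<in> carrier_vec m. ?D *\<^sub>v v = 0\<^sub>v n} \<subseteq> ?Z"
      proof
        fix y assume "y \<in> ac_comb b m ` {v \<in> carrier_vec m. ?D *\<^sub>v v = 0\<^sub>v n}"
        then obtain v where v: "v \<in> carrier_vec m" "?D *\<^sub>v v = 0\<^sub>v n" "y = ac_comb b m v" by auto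
        have "G a *\<^sub>v v - G c *\<^sub>v v = 0\<^sub>v n"
          using v(2) minus_mult_distrib_mat_vec[OF G G v(1)] by simp
        then have "(G a *\<^sub>v v - G c *\<^sub>v v) $ l = 0" if "l < n" for l using that by simp
        then have "G a *\<^sub>v v = G c *\<^sub>v v" using G[of a] G[of c] by (intro eq_vecI) auto
        then have "lin_poly K a y = lin_poly K c y" using Gv[OF _ v(1)] ac v(3) by metis
        then show "y \<in> ?Z" by (simp add: lin_poly_def left_diff_distrib sum_subtractf)
      qed
      show "finite ?Z" using card_lin_poly_roots(1)[of i K "\<lambda>i. a i - c i"] i by simp
    qed
    also have "\<dots> \<le> ?q ^ (K - 1)" using card_lin_poly_roots(2)[of i K "\<lambda>i. a i - c i"] i by simp
    finally have "m - mat_rank ?D \<le> K - 1"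
      using CARD_field_gt_1[where 'a='a] by (simp add: card_kernel_mat[OF D])
    then show ?thesis unfolding rank_dist_def K_def using d by linarith
  qed
  have "inj_on G E"
  proof (rule inj_onI, rule ccontr)
    fix a c assume "a \<in> E" "c \<in> E" "G a = G c" "a \<noteq> c"
    then have "d \<le> rank_dist (G c) (G c)" using dist[of a c] by simp
    then show False using rank_dist_self[OF G] d by simp
  qed
  then have "card (G ` E) = card E" by (rule card_image)
  also have "\<dots> = ?q ^ (n * K)"
    by (simp add: E_def card_PiE card_ac_subfield(2)[OF n] power_mult)
  finally have "card (G ` E) = ?q ^ (n * (m - d + 1))" by (simp add: K_def)
  moreover have "rank_metric_code n m d (G ` E)"
    unfolding rank_metric_code_def using G dist by auto
  ultimately show ?thesis by blast
qed

section \<open>Codes of size M(q,a,b,d)\<close>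

text \<open>Transposition keeps the rank of differences; it reduces matrices with fewer rows than
  columns to the other case.\<close>

lemma rank_metric_code_transpose:
  assumes "rank_metric_code n m d (C :: 'a::{field,finite} mat set)"
  shows "rank_metric_code m n d (transpose_mat ` C)" "card (transpose_mat ` C) = card C"
proof -
  have C: "Z \<in> carrier_mat n m" if "Z \<in> C" for Z
    using assms that by (auto simp: rank_metric_code_def)
  have "rank_dist (transpose_mat Z) (transpose_mat Y) = rank_dist Z Y" if "Z \<in> C" "Y \<in> C" for Z Y
    unfolding rank_dist_def using transpose_minus[OF C[OF that(1)] C[OF that(2)]]
    by (metis mat_rank_transpose)
  then show "rank_metric_code m n d (transpose_mat ` C)"
    using assms unfolding rank_metric_code_def by auto
  show "card (transpose_mat ` C) = card C"
    by (intro card_image inj_onI) (metis transpose_transpose)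
qed

text \<open>For \<open>d\<close> at most \<open>min a b\<close> this is a Delsarte-Gabidulin code or
  the transpose of one. For larger \<open>d\<close> the exponent is at most 0, the rounded value is
  1, and the zero matrix alone is a code.\<close>

lemma mrd_code_exists:
  assumes d: "1 \<le> d"
  shows "\<exists>C :: 'a::{field,finite} mat set. rank_metric_code a b d C \<and> card C = mrd_size (CARD('a)) a b d"
proof (cases "d \<le> min a b")
  case True
  have "int (max a b) * (int (min a b) - int d + 1) = int (max a b * (min a b - d + 1))"
    using True by (simp only: of_nat_mult of_nat_add of_nat_diff) simp
  then have size: "mrd_size (CARD('a)) a b d = CARD('a) ^ (max a b * (min a b - d + 1))"
    unfolding mrd_size_def by (simp only: power_int_of_nat of_nat_power[symmetric] ceiling_of_nat nat_int)
  show ?thesis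
  proof (cases "b \<le> a")
    case True
    then show ?thesis using gabidulin_code[of d b a, where 'a='a] d \<open>d \<le> min a b\<close> by (simp add: size)
  next
    case False
    then obtain C :: "'a mat set" where
      "rank_metric_code b a d C" "card C = CARD('a) ^ (b * (a - d + 1))"
      using gabidulin_code[of d a b, where 'a='a] d \<open>d \<le> min a b\<close> by auto
    then show ?thesis using rank_metric_code_transpose[of b a d C] False by (auto simp: size)
  qed
next
  case False
  let ?x = "real (CARD('a)) powi (int (max a b) * (int (min a b) - int d + 1))"
  have "0 < ?x" using CARD_field_gt_1[where 'a='a] by simp
  moreover have "int (max a b) * (int (min a b) - int d + 1) \<le> 0"
    using False by (intro mult_nonneg_nonpos) auto
  then have "?x \<le> real (CARD('a)) powi 0"
    using CARD_field_gt_1[where 'a='a] by (intro power_int_increasing) auto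
  ultimately have "\<lceil>?x\<rceil> = 1" by (simp add: ceiling_unique)
  then have "mrd_size (CARD('a)) a b d = 1" by (simp add: mrd_size_def)
  moreover have "rank_metric_code a b d {0\<^sub>m a b :: 'a mat}" by (simp add: rank_metric_code_def)
  ultimately show ?thesis by (intro exI[of _ "{0\<^sub>m a b}"]) simp
qed

section \<open>The lower bound\<close>

text \<open>Codes are subsets of a finite set, so only finitely many sizes occur, and the empty code
  provides one; hence \<open>Max\<close> is attained.\<close>

lemma
  fixes C :: "'a::{field,finite} vec set set"
  shows max_cdc_ge: "is_cdc v N d k C \<Longrightarrow> N \<le> max_cdc TYPE('a) v d k"
    and max_cdc_attained: "\<exists>D :: 'a vec set set. is_cdc v (max_cdc TYPE('a) v d k) d k D"
proof -
  let ?N = "{N. \<exists>C :: 'a vec set set. is_cdc v N d k C}"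
  have fin: "finite ?N"
  proof (rule finite_subset)
    show "?N \<subseteq> card ` Pow (Pow (carrier_vec v :: 'a vec set))"
    proof
      fix N assume "N \<in> ?N"
      then obtain D :: "'a vec set set" where "is_cdc v N d k D" by auto
      then have "N = card D" "D \<subseteq> Pow (carrier_vec v)"
        by (auto simp: is_cdc_def subspace_vec_iff)
      then show "N \<in> card ` Pow (Pow (carrier_vec v :: 'a vec set))" by blast
    qed
  qed (simp add: carrier_vec_finite_field(1))
  then show "is_cdc v N d k C \<Longrightarrow> N \<le> max_cdc TYPE('a) v d k"
    unfolding max_cdc_def by (intro Max_ge) auto
  have "is_cdc v 0 d k ({} :: 'a vec set set)" by (simp add: is_cdc_def)
  then have "?N \<noteq> {}" by blast
  then have "max_cdc TYPE('a) v d k \<in> ?N" unfolding max_cdc_def using fin by (rule Max_in[rotated])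
  then show "\<exists>D :: 'a vec set set. is_cdc v (max_cdc TYPE('a) v d k) d k D" by simp
qed

text \<open>Again the sizes form a finite nonempty set, here because there are finitely many
  matrices.\<close>

lemma max_bounded_rank_code_attained:
  "\<exists>C :: 'a::{field,finite} mat set. rank_metric_code a b d C \<and> (\<forall>Z\<in>C. mat_rank Z \<le> u) \<and>
     card C = max_bounded_rank_code TYPE('a) a b d u"
proof -
  let ?N = "{card C | C :: 'a mat set. rank_metric_code a b d C \<and> (\<forall>Z\<in>C. mat_rank Z \<le> u)}"
  have "?N \<subseteq> card ` Pow (carrier_mat a b :: 'a mat set)"
    by (auto simp: rank_metric_code_def)
  then have "finite ?N" by (rule finite_subset) (simp add: finite_carrier_mat)
  moreover have "rank_metric_code a b d ({} :: 'a mat set)" by (simp add: rank_metric_code_def)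
  then have "?N \<noteq> {}" by blast
  ultimately have "max_bounded_rank_code TYPE('a) a b d u \<in> ?N"
    unfolding max_bounded_rank_code_def by (rule Max_in)
  then show ?thesis by auto
qed

theorem theorem25:
  fixes q d k r s t :: nat
  assumes "q = CARD('a::{field,finite})"
    and "even d"
    and "2 \<le> d div 2" and "d div 2 \<le> k" and "2 * k \<le> r + s"
    and "k \<le> r" and "k \<le> s + t" and "t \<le> k - d div 2"
  shows
    "(\<forall>(\<A> :: 'a vec set set) (\<B> :: 'a vec set set) (\<M> :: 'a mat set) (\<R> :: 'a mat set).
        is_cdc r (card \<A>) d k \<A> \<and>
        is_cdc (s + t) (card \<B>) d k \<B> \<and>
        rank_metric_code k s (d div 2) \<M> \<and>
        rank_metric_code k (r - t) (d div 2) \<R> \<and>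
        (\<forall>R\<in>\<R>. mat_rank R \<le> k - d div 2 - t) \<longrightarrow>
        is_cdc (r + s) (card \<A> * card \<M> + card \<R> * card \<B>) d k
          ({tau_inv (tau r A @\<^sub>c M) | A M. A \<in> \<A> \<and> M \<in> \<M>} \<union>
           {tau_inv (R @\<^sub>c tau (s + t) B) | R B. R \<in> \<R> \<and> B \<in> \<B>})) \<and>
     max_cdc TYPE('a) (r + s) d k \<ge>
       max_cdc TYPE('a) r d k * mrd_size q k s (d div 2) +
       max_cdc TYPE('a) (s + t) d k *
         max_bounded_rank_code TYPE('a) k (r - t) (d div 2) (k - d div 2 - t)"
proof (intro conjI allI impI)
  define e where "e = d div 2"
  have d: "d = 2 * e" using \<open>even d\<close> by (simp add: e_def)
  have e: "1 \<le> e" "e \<le> k" and t: "t \<le> k - e" using assms by (auto simp: e_def)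
  note cdc = generalized_linkage_is_cdc[OF e t \<open>k \<le> r\<close>, where s = s]
  {
    fix \<A> \<B> :: "'a vec set set" and \<M> \<R> :: "'a mat set"
    assume "is_cdc r (card \<A>) d k \<A> \<and> is_cdc (s + t) (card \<B>) d k \<B> \<and>
      rank_metric_code k s (d div 2) \<M> \<and> rank_metric_code k (r - t) (d div 2) \<R> \<and>
      (\<forall>R\<in>\<R>. mat_rank R \<le> k - d div 2 - t)"
    then show "is_cdc (r + s) (card \<A> * card \<M> + card \<R> * card \<B>) d k
          ({tau_inv (tau r A @\<^sub>c M) | A M. A \<in> \<A> \<and> M \<in> \<M>} \<union>
           {tau_inv (R @\<^sub>c tau (s + t) B) | R B. R \<in> \<R> \<and> B \<in> \<B>})"
      unfolding d using cdc[of \<A> \<B> \<M> \<R>] by simp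
  }
  \<comment> \<open>For the numerical bound the constant-dimension and bounded-rank codes are taken
    optimal, the remaining one of size M(q,k,s,e).\<close>
  obtain \<A> :: "'a vec set set" where A: "is_cdc r (max_cdc TYPE('a) r d k) d k \<A>"
    using max_cdc_attained by blast
  obtain \<B> :: "'a vec set set" where B: "is_cdc (s + t) (max_cdc TYPE('a) (s + t) d k) d k \<B>"
    using max_cdc_attained by blast
  obtain \<M> :: "'a mat set" where M: "rank_metric_code k s e \<M>" "card \<M> = mrd_size q k s e"
    using mrd_code_exists[OF e(1), where 'a='a] \<open>q = CARD('a)\<close> by blast
  obtain \<R> :: "'a mat set" where R: "rank_metric_code k (r - t) e \<R>" "\<And>R. R \<in> \<R> \<Longrightarrow> mat_rank R \<le> k - e - t"
      "card \<R> = max_bounded_rank_code TYPE('a) k (r - t) e (k - e - t)"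
    using max_bounded_rank_code_attained by metis
  have card: "card \<A> = max_cdc TYPE('a) r d k" "card \<B> = max_cdc TYPE('a) (s + t) d k"
    using A B by (auto simp: is_cdc_def)
  have "card \<A> * card \<M> + card \<R> * card \<B> \<le> max_cdc TYPE('a) (r + s) d k"
    using cdc[of \<A> \<B> \<M> \<R>] A B M(1) R(1,2) card unfolding d by (intro max_cdc_ge) simp
  then show "max_cdc TYPE('a) r d k * mrd_size q k s (d div 2) +
      max_cdc TYPE('a) (s + t) d k * max_bounded_rank_code TYPE('a) k (r - t) (d div 2) (k - d div 2 - t)
      \<le> max_cdc TYPE('a) (r + s) d k"
    unfolding card M(2) R(3) e_def by (simp add: mult.commute)
qed

end
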